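(* For every $x\in E$, $$\lim_{h\to0}\Bigl|\inf_{V\in\mathbb V_h}J_h(x,V)-\inf_{V\in\mathbb V_h}J(x,V)\Bigr|=0.$$
   Context: Process. $X=(X_t)_{t\ge0}$ is a continuous-time standard Feller–Markov process on a filtered space $(\Omega,\mathcal F,(\mathcal F_t))$ (standard in the usual sense of Markov process theory) with values in a compact metric space $(E,\rho)$ with Borel $\sigma$-field $\mathcal E$; $\mathbb P_x,\mathbb E_x$ are the law and expectation for the process started at $x\in E$, and $P_t(x,A):=\mathbb P_x[X_t\in A]$. The set of admissible after-impulse states is $U=E$. $\mathcal C_b(E)$ is the space of bounded continuous real functions on $E$. Standing assumptions. (1) $g:E\to\mathbb R$ is continuous and bounded; $c:E\times U\to\mathbb R_+$ is continuous and bounded, and for some $c_0>0$ we have $0<c_0\le c(x,\xi)\le c(x,\eta)+c(\eta,\xi)$ for $x,\xi,\eta\in E$. (2) For every $f\in\mathcal C_b(E)$ and $t>0$, the map $x\mapsto\mathbb E_x[f(X_t)]$ is in $\mathcal C_b(E)$. (3) For every $t>0$ there is $\Lambda_t\in(0,1)$ with $\sup_{x,y\in E}\sup_{A\in\mathcal E}|P_t(x,A)-P_t(y,A)|\le\Lambda_t$. Impulse control. A strategy is a sequence $V=(\tau_i,\xi_i)_{i=1}^\infty$ with $(\tau_i)$ an increasing (weakly, values in $[0,\infty]$) sequence of stopping times and $\xi_i$ $\mathcal F_{\tau_i}$-measurable $U$-valued random variables; $\mathbb V$ is the family of all strategies, and for $h>0$, $\mathbb V_h\subset\mathbb V$ consists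 of those with impulse times restricted to $\{0,h,2h,\dots\}$ (or $\infty$, i.e. no impulse). On a countable product of copies of $(\Omega,\mathcal F,(\mathcal F_t))$ with coordinate process $(X^1_t,X^2_t,\dots)$, to each $x\in E$ and $V\in\mathbb V$ one associates a probability $\mathbb P^V_x$ (expectation $\mathbb E^V_x$) under which $X^1$ follows the uncontrolled dynamics from $x$ and, for each $i\ge1$, on $\{\tau_i<\infty\}$, $X^{i+1}_{\tau_i}=\xi_i$ and from time $\tau_i$ on $X^{i+1}$ follows the uncontrolled dynamics started afresh from $\xi_i$ (conditionally on the past). The controlled process is $Y_t:=X^i_t$ for $t\in[\tau_{i-1},\tau_i)$, $\tau_0\equiv0$. Functionals. For $x\in E$ and $V\in\mathbb V$, $$J(x,V):=\limsup_{T\to\infty}\frac{\mathbb E^V_x\bigl[\int_0^Tg(Y_s)ds+\sum_{i=1}^\infty1_{\{\tau_i\le T\}}c(X^i_{\tau_i},X^{i+1}_{\tau_i})\bigr]}{T},$$ and, for $V\in\mathbb V_h$, $$J_h(x,V):=\limsup_{n\to\infty}\frac1n\mathbb E^V_x\Bigl[\sum_{i=1}^{n}g(Y_{ih})+\sum_{i=1}^\infty1_{\{\tau_i\le nh\}}\tfrac1h c(X^i_{\tau_i},X^{i+1}_{\tau_i})\Bigr].$$ *)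

theory Defs
  imports "HOL-Probability.Probability"
begin

text \<open>
  Conventions. \<open>(\<Omega>, \<F>)\<close> is \<open>(space M, sets M)\<close>. Filtrations are indexed by \<open>[0,\<infinity>]\<close>, i.e. by
  \<^typ>\<open>ennreal\<close>, because stopping times may be infinite; \<open>F \<infinity>\<close> is any sub-\<open>\<sigma>\<close>-field of \<open>\<F>\<close>
  containing all \<open>F t\<close>. A process \<open>X :: real \<Rightarrow> _\<close> is only looked at for times \<open>t \<ge> 0\<close>.
  \<open>P x\<close> is the law on \<open>\<Omega>\<close> of the process started at \<open>x\<close>.
\<close>

definition transition_prob ::
    "('e \<Rightarrow> 'w measure) \<Rightarrow> (real \<Rightarrow> 'w \<Rightarrow> 'e) \<Rightarrow> real \<Rightarrow> 'e \<Rightarrow> 'e set \<Rightarrow> real" where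
  "transition_prob P X t x A = measure (P x) {\<omega> \<in> space (P x). X t \<omega> \<in> A}"

definition transition_op ::
    "('e \<Rightarrow> 'w measure) \<Rightarrow> (real \<Rightarrow> 'w \<Rightarrow> 'e) \<Rightarrow> real \<Rightarrow> ('e \<Rightarrow> real) \<Rightarrow> 'e \<Rightarrow> real" where
  "transition_op P X t f x = (\<integral>\<omega>. f (X t \<omega>) \<partial>P x)"

definition markov_process ::
    "'w measure \<Rightarrow> (ennreal \<Rightarrow> 'w measure) \<Rightarrow> (real \<Rightarrow> 'w \<Rightarrow> 'e::topological_space)
      \<Rightarrow> ('e \<Rightarrow> 'w measure) \<Rightarrow> bool" where
  "markov_process M F X P \<longleftrightarrow>
     filtration (space M) F \<and>
     (\<forall>t. sets (F t) \<subseteq> sets M) \<and>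
     (\<forall>t\<ge>0. X t \<in> measurable (F (ennreal t)) borel) \<and>
     (\<forall>x. prob_space (P x) \<and> sets (P x) = sets M) \<and>
     (\<forall>x. AE \<omega> in P x. X 0 \<omega> = x) \<and>
     (\<forall>t\<ge>0. \<forall>A\<in>sets borel. (\<lambda>x. transition_prob P X t x A) \<in> borel_measurable borel) \<and>
     (\<forall>x. \<forall>t\<ge>0. \<forall>s\<ge>0. \<forall>f\<in>bcontfun. AE \<omega> in P x.
        real_cond_exp (P x) (F (ennreal t)) (\<lambda>\<omega>. f (X (t + s) \<omega>)) \<omega>
          = transition_op P X s f (X t \<omega>))"

text \<open>
  Standard processes: right-continuous filtration and paths, left limits, the strong Markov
  property and quasi-left-continuity. The process is conservative, so no cemetery state is needed.
  Completeness of the filtration is not demanded: complete and incomplete filtrations are both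
  covered.
\<close>

definition standard_process ::
    "'w measure \<Rightarrow> (ennreal \<Rightarrow> 'w measure) \<Rightarrow> (real \<Rightarrow> 'w \<Rightarrow> 'e::topological_space)
      \<Rightarrow> ('e \<Rightarrow> 'w measure) \<Rightarrow> bool" where
  "standard_process M F X P \<longleftrightarrow>
     markov_process M F X P \<and>
     (\<forall>t<\<infinity>. sets (F t) = (\<Inter>u\<in>{t<..}. sets (F u))) \<and>
     (\<forall>\<omega>\<in>space M. \<forall>t\<ge>0. continuous (at_right t) (\<lambda>s. X s \<omega>)) \<and>
     (\<forall>x. AE \<omega> in P x. \<forall>t>0. \<exists>l. ((\<lambda>s. X s \<omega>) \<longlongrightarrow> l) (at_left t)) \<and>
     (\<forall>x \<tau>. stopping_time F \<tau> \<longrightarrow>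
        (\<forall>s\<ge>0. \<forall>f\<in>bcontfun. AE \<omega> in P x. \<tau> \<omega> < \<infinity> \<longrightarrow>
           real_cond_exp (P x) (filtration.pre_sigma (space M) F \<tau>)
               (\<lambda>\<omega>. f (X (enn2real (\<tau> \<omega>) + s) \<omega>)) \<omega>
             = transition_op P X s f (X (enn2real (\<tau> \<omega>)) \<omega>))) \<and>
     (\<forall>x \<sigma>. (\<forall>n::nat. stopping_time F (\<sigma> n)) \<and> (\<forall>\<omega>\<in>space M. incseq (\<lambda>n. \<sigma> n \<omega>)) \<longrightarrow>
        (AE \<omega> in P x. (SUP n. \<sigma> n \<omega>) < \<infinity> \<longrightarrow>
           (\<lambda>n. X (enn2real (\<sigma> n \<omega>)) \<omega>) \<longlonglongrightarrow> X (enn2real (SUP n. \<sigma> n \<omega>)) \<omega>))"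

definition feller_property ::
    "(real \<Rightarrow> 'w \<Rightarrow> 'e::metric_space) \<Rightarrow> ('e \<Rightarrow> 'w measure) \<Rightarrow> bool" where
  "feller_property X P \<longleftrightarrow> (\<forall>t>0. \<forall>f\<in>bcontfun. transition_op P X t f \<in> bcontfun)"

definition uniformly_ergodic ::
    "(real \<Rightarrow> 'w \<Rightarrow> 'e::topological_space) \<Rightarrow> ('e \<Rightarrow> 'w measure) \<Rightarrow> bool" where
  "uniformly_ergodic X P \<longleftrightarrow>
     (\<forall>t>0. \<exists>\<Lambda>. 0 < \<Lambda> \<and> \<Lambda> < 1 \<and>
        (\<forall>x y. \<forall>A\<in>sets borel. \<bar>transition_prob P X t x A - transition_prob P X t y A\<bar> \<le> \<Lambda>))"

text \<open>
  Coordinates of \<open>\<Omega>\<^sup>\<nat>\<close> and impulses are counted from \<open>0\<close>: coordinate \<open>k\<close> carries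
  \<open>X\<^sup>k\<^sup>+\<^sup>1\<close>, and \<open>V k\<close> is the pair \<open>(\<tau>, \<xi>)\<close> with index \<open>k + 1\<close>. The \<open>n\<close>-th product filtration
  \<open>F\<^sub>t \<otimes> \<dots> \<otimes> F\<^sub>t \<otimes> {\<emptyset>,\<Omega>} \<otimes> \<dots>\<close> sees the first \<open>n\<close> coordinates only; the impulse \<open>V k\<close> is
  decided from the first \<open>k + 1\<close> of them.
\<close>

type_synonym ('w, 'e) strategy = "nat \<Rightarrow> ((nat \<Rightarrow> 'w) \<Rightarrow> ennreal) \<times> ((nat \<Rightarrow> 'w) \<Rightarrow> 'e)"

definition imp_time :: "('w, 'e) strategy \<Rightarrow> nat \<Rightarrow> (nat \<Rightarrow> 'w) \<Rightarrow> ennreal" where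
  "imp_time V k = fst (V k)"

definition imp_state :: "('w, 'e) strategy \<Rightarrow> nat \<Rightarrow> (nat \<Rightarrow> 'w) \<Rightarrow> 'e" where
  "imp_state V k = snd (V k)"

definition path_product :: "'w measure \<Rightarrow> (nat \<Rightarrow> 'w) measure" where
  "path_product M = (\<Pi>\<^sub>M j\<in>UNIV. M)"

definition product_filtration ::
    "'w measure \<Rightarrow> (ennreal \<Rightarrow> 'w measure) \<Rightarrow> nat \<Rightarrow> ennreal \<Rightarrow> (nat \<Rightarrow> 'w) measure" where
  "product_filtration M F n t = (\<Pi>\<^sub>M j\<in>UNIV. if j < n then F t else sigma (space M) {})"

abbreviation product_pre_sigma ::
    "'w measure \<Rightarrow> (ennreal \<Rightarrow> 'w measure) \<Rightarrow> nat \<Rightarrow> ((nat \<Rightarrow> 'w) \<Rightarrow> ennreal) \<Rightarrow> (nat \<Rightarrow> 'w) measure" where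
  "product_pre_sigma M F n \<tau> \<equiv>
     filtration.pre_sigma (space (path_product M)) (product_filtration M F n) \<tau>"

definition strategies ::
    "'w measure \<Rightarrow> (ennreal \<Rightarrow> 'w measure) \<Rightarrow> ('w, 'e::topological_space) strategy set" where
  "strategies M F =
     {V. (\<forall>k. stopping_time (product_filtration M F (Suc k)) (imp_time V k)) \<and>
         (\<forall>k. imp_state V k \<in> measurable (product_pre_sigma M F (Suc k) (imp_time V k)) borel) \<and>
         (\<forall>\<omega>\<in>space (path_product M). \<forall>k. imp_time V k \<omega> \<le> imp_time V (Suc k) \<omega>)}"

definition grid_strategies ::
    "'w measure \<Rightarrow> (ennreal \<Rightarrow> 'w measure) \<Rightarrow> real \<Rightarrow> ('w, 'e::topological_space) strategy set" where
  "grid_strategies M F h =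
     {V \<in> strategies M F. \<forall>\<omega>\<in>space (path_product M). \<forall>k.
        imp_time V k \<omega> \<in> insert \<infinity> (range (\<lambda>n::nat. ennreal (real n * h)))}"

text \<open>
  The properties of the controlled law from \<open>x\<close> under \<open>V\<close>: the last clause says that after the
  impulse \<open>V k\<close> the next coordinate is, conditionally on the past observed on the coordinates
  \<open>0, \<dots>, k + 1\<close>, Markov with the uncontrolled transition semigroup.
\<close>

definition controlled_law ::
    "'w measure \<Rightarrow> (ennreal \<Rightarrow> 'w measure) \<Rightarrow> (real \<Rightarrow> 'w \<Rightarrow> 'e::metric_space) \<Rightarrow> ('e \<Rightarrow> 'w measure)
      \<Rightarrow> 'e \<Rightarrow> ('w, 'e) strategy \<Rightarrow> (nat \<Rightarrow> 'w) measure \<Rightarrow> bool" where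
  "controlled_law M F X P x V Q \<longleftrightarrow>
     prob_space Q \<and> sets Q = sets (path_product M) \<and>
     distr Q M (\<lambda>\<omega>. \<omega> 0) = P x \<and>
     (\<forall>k. AE \<omega> in Q. imp_time V k \<omega> < \<infinity> \<longrightarrow>
        X (enn2real (imp_time V k \<omega>)) (\<omega> (Suc k)) = imp_state V k \<omega>) \<and>
     (\<forall>k. \<forall>t\<ge>0. \<forall>s\<ge>0. \<forall>f\<in>bcontfun. AE \<omega> in Q. imp_time V k \<omega> < \<infinity> \<longrightarrow>
        real_cond_exp Q (product_pre_sigma M F (Suc (Suc k)) (\<lambda>\<omega>. imp_time V k \<omega> + ennreal t))
            (\<lambda>\<omega>. f (X (enn2real (imp_time V k \<omega>) + t + s) (\<omega> (Suc k)))) \<omega>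
          = transition_op P X s f (X (enn2real (imp_time V k \<omega>) + t) (\<omega> (Suc k))))"

text \<open>
  The active coordinate at time \<open>t\<close> is the first one whose terminating impulse lies after \<open>t\<close>. If
  infinitely many impulses occur up to time \<open>t\<close>, then \<open>LEAST\<close> is an arbitrary constant; unless
  this is a null event, the expected cost up to time \<open>t\<close> is infinite anyway, impulse costs being
  bounded away from \<open>0\<close>.
\<close>

definition controlled_process ::
    "(real \<Rightarrow> 'w \<Rightarrow> 'e) \<Rightarrow> ('w, 'e) strategy \<Rightarrow> real \<Rightarrow> (nat \<Rightarrow> 'w) \<Rightarrow> 'e" where
  "controlled_process X V t \<omega> = X t (\<omega> (LEAST k. ennreal t < imp_time V k \<omega>))"

definition impulse_cost ::
    "(real \<Rightarrow> 'w \<Rightarrow> 'e) \<Rightarrow> ('e \<Rightarrow> 'e \<Rightarrow> real) \<Rightarrow> ('w, 'e) strategy \<Rightarrow> nat \<Rightarrow> (nat \<Rightarrow> 'w) \<Rightarrow> real" where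
  "impulse_cost X c V k \<omega> =
     (let t = enn2real (imp_time V k \<omega>) in c (X t (\<omega> k)) (X t (\<omega> (Suc k))))"

text \<open>Expectation of an extended real random variable, as positive minus negative part.\<close>

definition ereal_expectation :: "'a measure \<Rightarrow> ('a \<Rightarrow> ereal) \<Rightarrow> ereal" where
  "ereal_expectation Q Z =
     enn2ereal (\<integral>\<^sup>+\<omega>. e2ennreal (Z \<omega>) \<partial>Q) - enn2ereal (\<integral>\<^sup>+\<omega>. e2ennreal (- Z \<omega>) \<partial>Q)"

definition avg_cost ::
    "(real \<Rightarrow> 'w \<Rightarrow> 'e) \<Rightarrow> ('e \<Rightarrow> real) \<Rightarrow> ('e \<Rightarrow> 'e \<Rightarrow> real)
      \<Rightarrow> ('e \<Rightarrow> ('w, 'e) strategy \<Rightarrow> (nat \<Rightarrow> 'w) measure) \<Rightarrow> 'e \<Rightarrow> ('w, 'e) strategy \<Rightarrow> ereal" where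
  "avg_cost X g c PV x V =
     Limsup at_top (\<lambda>T::real.
       ereal_expectation (PV x V) (\<lambda>\<omega>.
         ereal (LINT s:{0..T}|lborel. g (controlled_process X V s \<omega>))
         + enn2ereal (\<Sum>k. if imp_time V k \<omega> \<le> ennreal T
             then ennreal (impulse_cost X c V k \<omega>) else 0))
       / ereal T)"

definition discrete_avg_cost ::
    "(real \<Rightarrow> 'w \<Rightarrow> 'e) \<Rightarrow> ('e \<Rightarrow> real) \<Rightarrow> ('e \<Rightarrow> 'e \<Rightarrow> real)
      \<Rightarrow> ('e \<Rightarrow> ('w, 'e) strategy \<Rightarrow> (nat \<Rightarrow> 'w) measure) \<Rightarrow> real \<Rightarrow> 'e \<Rightarrow> ('w, 'e) strategy \<Rightarrow> ereal" where
  "discrete_avg_cost X g c PV h x V =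
     limsup (\<lambda>n::nat.
       ereal (1 / real n) * ereal_expectation (PV x V) (\<lambda>\<omega>.
         ereal (\<Sum>i=1..n. g (controlled_process X V (real i * h) \<omega>))
         + enn2ereal (\<Sum>k. if imp_time V k \<omega> \<le> ennreal (real n * h)
             then ennreal (1 / h * impulse_cost X c V k \<omega>) else 0)))"

end

theory Submission
  imports Defs
begin

text \<open>
  The two functionals are compared strategy by strategy. Let \<open>P\<^sub>t\<close> be the transition semigroup, fix
  \<open>h > 0\<close>, and let \<open>e\<close> bound \<open>\<bar>P\<^sub>r g - g\<bar>\<close> uniformly for \<open>0 \<le> r < h\<close>. For a strategy \<open>V\<close> with impulses on
  the grid \<open>{0, h, 2h, \<dots>}\<close> the controlled process \<open>Y\<close> follows, between two grid times, the uncontrolled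
  dynamics started from its value at the earlier one. Hence \<open>E g(Y\<^sub>s)\<close> and \<open>E g(Y\<^sub>i\<^sub>h)\<close> differ by at
  most \<open>e\<close> for \<open>i h \<le> s < (i + 1) h\<close> (lemma \<open>expected_increment\<close>). The impulse costs are the same in both
  functionals up to the factor \<open>1 / h\<close>, so up to time \<open>T\<close> the expected continuous cost and \<open>h\<close> times
  the expected discrete cost differ by at most \<open>T e\<close> plus a constant
  (lemma \<open>expected_cost_comparison\<close>), and the long-run averages by at most \<open>e\<close>
  (lemma \<open>average_cost_comparison\<close>). The bound does not depend on \<open>V\<close>, so it passes to the infima, which are finite
  because \<open>g\<close> is bounded and one may abstain from impulses.

  The argument needs almost surely finitely many impulses in finite time. As every impulse costs
  at least \<open>c0 > 0\<close>, a strategy that violates this makes both functionals infinite.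

  It remains to see that \<open>e\<close> can be taken small with \<open>h\<close>, that is, that a Feller semigroup with
  right-continuous paths on a compact space is strongly continuous (lemma
  \<open>semigroup_strongly_continuous\<close>). Right-continuity gives \<open>P\<^sub>t g \<longlongrightarrow> g\<close> pointwise only. The
  passage to uniform convergence is done by a compactness argument with supermedian functions, whose
  discounted images under the semigroup decrease in time: if \<open>g \<ge> 0\<close>, which adding a
  constant achieves, then some minimum of finitely many resolvents of \<open>g\<close> is supermedian, lies below \<open>g\<close> up to a
  small error, and is close to \<open>g\<close> at a given point.
\<close>

section \<open>Right-continuous families of functions\<close>

text \<open>
  The value at \<open>max 0 s\<close> is the limit of the values at the grid points \<open>(k + 1) / (m + 1)\<close>
  immediately to the right of it, and each of these approximations depends on \<open>s\<close> through a countable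
  index only. The limit is taken strictly from the right, hence through positive times. Truncating at
  \<open>0\<close> extends the family to the whole time axis.
\<close>

lemma right_continuous_jointly_measurable:
  fixes \<phi> :: "real \<Rightarrow> 'a \<Rightarrow> real"
  assumes meas: "\<And>s. 0 < s \<Longrightarrow> \<phi> s \<in> borel_measurable N"
    and rc: "\<And>s a. 0 \<le> s \<Longrightarrow> a \<in> space N \<Longrightarrow> continuous (at_right s) (\<lambda>s. \<phi> s a)"
  shows "(\<lambda>(s, a). \<phi> (max 0 s) a) \<in> borel_measurable (borel \<Otimes>\<^sub>M N)"
proof (rule borel_measurable_LIMSEQ_real)
  define k where "k m s = nat \<lfloor>max 0 s * real (Suc m)\<rfloor>" for m and s :: real
  define a where "a m n = (real n + 1) / real (Suc m)" for m n
  define u where "u m = (\<lambda>(s, b). \<phi> (a m (k m s)) b)" for m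
  show "u m \<in> borel_measurable (borel \<Otimes>\<^sub>M N)" for m
  proof -
    have "(\<lambda>p. \<phi> (a m (k m (fst p))) (snd p)) \<in> borel_measurable (borel \<Otimes>\<^sub>M N)"
    proof (rule measurable_compose_countable[where g="\<lambda>p. k m (fst p)" and f="\<lambda>n p. \<phi> (a m n) (snd p)"])
      show "(\<lambda>p. \<phi> (a m n) (snd p)) \<in> borel_measurable (borel \<Otimes>\<^sub>M N)" for n
        by (rule measurable_compose[OF measurable_snd meas]) (simp add: a_def)
      show "(\<lambda>p. k m (fst p)) \<in> borel \<Otimes>\<^sub>M N \<rightarrow>\<^sub>M count_space UNIV"
        unfolding k_def by measurable
    qed
    then show ?thesis by (simp add: u_def split_beta')
  qed
  fix p :: "real \<times> 'a" assume p: "p \<in> space (borel \<Otimes>\<^sub>M N)"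
  obtain s b where sb: "p = (s, b)" by (cases p)
  have b: "b \<in> space N" using p sb by (simp add: space_pair_measure)
  have k: "real (k m s) = of_int \<lfloor>max 0 s * real (Suc m)\<rfloor>" for m
    by (simp add: k_def)
  have gt: "max 0 s < a m (k m s)" for m
    unfolding a_def k by (simp add: less_divide_eq)
  have le: "a m (k m s) \<le> max 0 s + 1 / real (Suc m)" for m
  proof -
    have "a m (k m s) \<le> (max 0 s * real (Suc m) + 1) / real (Suc m)"
      unfolding a_def k by (rule divide_right_mono) linarith+
    also have "\<dots> = max 0 s + 1 / real (Suc m)" by (simp add: add_divide_distrib)
    finally show ?thesis .
  qed
  have "(\<lambda>m. inverse (real (Suc m))) \<longlonglongrightarrow> 0"
    by (rule LIMSEQ_inverse_real_of_nat)
  from tendsto_add[OF tendsto_const[of "max 0 s"] this]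
  have "(\<lambda>m. max 0 s + 1 / real (Suc m)) \<longlonglongrightarrow> max 0 s"
    by (simp only: inverse_eq_divide add_0_right)
  then have "(\<lambda>m. a m (k m s)) \<longlonglongrightarrow> max 0 s"
    by (rule tendsto_sandwich[OF always_eventually[OF allI[OF less_imp_le[OF gt]]]
          always_eventually[OF allI[OF le]] tendsto_const])
  then have lim: "filterlim (\<lambda>m. a m (k m s)) (at_right (max 0 s)) sequentially"
    unfolding filterlim_at using gt by (auto simp: less_imp_neq[symmetric])
  have "((\<lambda>s. \<phi> s b) \<longlongrightarrow> \<phi> (max 0 s) b) (at_right (max 0 s))"
    using rc[of "max 0 s" b] b by (simp add: continuous_within)
  from filterlim_compose[OF this lim] have "(\<lambda>m. \<phi> (a m (k m s)) b) \<longlonglongrightarrow> \<phi> (max 0 s) b" .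
  then show "(\<lambda>m. u m p) \<longlonglongrightarrow> (case p of (s, a) \<Rightarrow> \<phi> (max 0 s) a)"
    by (simp add: u_def sb)
qed

section \<open>The transition semigroup\<close>

lemma bcontfun_compact:
  fixes f :: "'e::metric_space \<Rightarrow> real"
  assumes "compact (UNIV :: 'e set)" "continuous_on UNIV f"
  shows "f \<in> bcontfun"
  using assms compact_continuous_image[of UNIV f] by (auto simp: bcontfun_def intro: compact_imp_bounded)

lemma bcontfun_bound:
  fixes f :: "'e::metric_space \<Rightarrow> real"
  assumes "f \<in> bcontfun"
  obtains B where "0 \<le> B" "\<And>y. \<bar>f y\<bar> \<le> B"
proof -
  obtain B where B: "\<And>y. norm (f y) \<le> B"
    using assms by (auto simp: bcontfun_def bounded_iff)
  have "0 \<le> B" using B[of undefined] norm_ge_zero order_trans by blast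
  then show thesis using that B by auto
qed

lemma bcontfun_borel_measurable: "(f :: 'e::metric_space \<Rightarrow> real) \<in> bcontfun \<Longrightarrow> f \<in> borel_measurable borel"
  by (auto simp: bcontfun_def intro: borel_measurable_continuous_onI)

locale compact_feller_process =
  fixes M :: "'w measure" and F :: "ennreal \<Rightarrow> 'w measure"
    and X :: "real \<Rightarrow> 'w \<Rightarrow> 'e::{metric_space, second_countable_topology}" and P :: "'e \<Rightarrow> 'w measure"
  assumes markov: "markov_process M F X P"
    and paths: "\<And>\<omega> t. \<omega> \<in> space M \<Longrightarrow> 0 \<le> t \<Longrightarrow> continuous (at_right t) (\<lambda>s. X s \<omega>)"
    and compact_space: "compact (UNIV :: 'e set)"
    and feller: "feller_property X P"
begin

abbreviation "Pt \<equiv> transition_op P X"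


lemma filtration_F: "filtration (space M) F"
  using markov by (simp add: markov_process_def)

lemma space_F: "space (F t) = space M"
  using filtration_F by (rule filtration.space_F)

lemma sets_F: "sets (F t) \<subseteq> sets M"
  using markov by (simp add: markov_process_def)

lemma X_adapted: "0 \<le> t \<Longrightarrow> X t \<in> measurable (F (ennreal t)) borel"
  using markov by (simp add: markov_process_def)

lemma X_measurable: "0 \<le> t \<Longrightarrow> X t \<in> borel_measurable M"
  using X_adapted[of t] sets_F[of t] space_F[of t] by (auto simp: measurable_def)

lemma prob_space_P: "prob_space (P y)"
  using markov by (simp add: markov_process_def)

lemma sets_P: "sets (P y) = sets M"
  using markov by (simp add: markov_process_def)

lemma space_P: "space (P y) = space M"
  using sets_P by (rule sets_eq_imp_space_eq)

lemma initial_state: "AE \<omega> in P y. X 0 \<omega> = y"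
  using markov by (simp add: markov_process_def)

lemma measurable_comp_X:
  assumes "0 \<le> t" "f \<in> bcontfun" shows "(\<lambda>\<omega>. f (X t \<omega>) :: real) \<in> borel_measurable M"
  using X_measurable[OF assms(1)] bcontfun_borel_measurable[OF assms(2)] by measurable

lemma integrable_comp_X:
  assumes "0 \<le> t" "f \<in> bcontfun" shows "integrable (P y) (\<lambda>\<omega>. f (X t \<omega>) :: real)"
proof -
  interpret prob_space "P y" by (rule prob_space_P)
  obtain B where "\<And>y. \<bar>f y\<bar> \<le> B" using bcontfun_bound[OF assms(2)] by metis
  then show ?thesis
    using measurable_comp_X[OF assms] by (intro integrable_const_bound[of _ B]) (auto simp: measurable_cong_sets[OF sets_P refl])
qed


lemma op_bcontfun: "0 < t \<Longrightarrow> f \<in> bcontfun \<Longrightarrow> Pt t f \<in> bcontfun"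
  using feller by (simp add: feller_property_def)

lemma op_zero:
  assumes "f \<in> bcontfun" shows "Pt 0 f = (f :: 'e \<Rightarrow> real)"
proof
  fix y
  interpret prob_space "P y" by (rule prob_space_P)
  have "Pt 0 f y = (\<integral>\<omega>. f y \<partial>P y)"
    unfolding transition_op_def
    using initial_state[of y] measurable_comp_X[of 0 f] assms
    by (intro integral_cong_AE) (auto simp: measurable_cong_sets[OF sets_P refl])
  then show "Pt 0 f y = f y" by (simp add: prob_space)
qed

lemma op_bcontfun': "0 \<le> t \<Longrightarrow> f \<in> bcontfun \<Longrightarrow> Pt t f \<in> bcontfun"
  using op_bcontfun[of t f] op_zero[of f] by (cases "t = 0") auto

lemma op_mono:
  assumes "0 \<le> t" "f \<in> bcontfun" "g \<in> bcontfun" "\<And>z. f z \<le> (g z :: real)"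
  shows "Pt t f y \<le> Pt t g y"
  unfolding transition_op_def using assms by (intro integral_mono integrable_comp_X) auto

lemma op_const: "Pt t (\<lambda>_. K) y = K"
proof -
  interpret prob_space "P y" by (rule prob_space_P)
  show ?thesis by (simp add: transition_op_def prob_space)
qed

lemma op_add_const:
  assumes "0 \<le> t" "f \<in> bcontfun"
  shows "Pt t (\<lambda>z. a * f z + b) y = a * Pt t f y + (b :: real)"
proof -
  interpret prob_space "P y" by (rule prob_space_P)
  show ?thesis
    unfolding transition_op_def using integrable_comp_X[OF assms] by (simp add: prob_space)
qed

lemma op_bounded:
  assumes "0 \<le> t" "f \<in> bcontfun" "\<And>z. \<bar>f z\<bar> \<le> (B :: real)"
  shows "\<bar>Pt t f y\<bar> \<le> B"
  using op_mono[of t f "\<lambda>_. B" y] op_mono[of t "\<lambda>_. - B" f y] assms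
  by (auto simp: op_const const_bcontfun abs_le_iff minus_le_iff)

lemma markov_conditional:
  assumes "0 \<le> t" "0 \<le> s" "f \<in> bcontfun"
  shows "AE \<omega> in P y. real_cond_exp (P y) (F (ennreal t)) (\<lambda>\<omega>. f (X (t + s) \<omega>)) \<omega> = Pt s f (X t \<omega>)"
proof -
  have "\<forall>x. \<forall>t\<ge>0. \<forall>s\<ge>0. \<forall>f\<in>bcontfun. AE \<omega> in P x.
      real_cond_exp (P x) (F (ennreal t)) (\<lambda>\<omega>. f (X (t + s) \<omega>)) \<omega> = Pt s f (X t \<omega>)"
    using markov unfolding markov_process_def by (elim conjE)
  from this[rule_format, OF assms] show ?thesis .
qed

text \<open>
  The form in which the Markov property is used: two conditionally equal functions have the same
  integral over every event of the conditioning \<open>\<sigma>\<close>-field.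
\<close>

lemma markov_on_set:
  assumes A: "A \<in> sets (F (ennreal t))" and t: "0 \<le> t" "0 \<le> s" and f: "f \<in> bcontfun"
  shows "(\<integral>\<omega>\<in>A. f (X (t + s) \<omega>) \<partial>P y) = (\<integral>\<omega>\<in>A. transition_op P X s f (X t \<omega>) \<partial>P y)"
proof -
  interpret prob_space "P y" by (rule prob_space_P)
  interpret S: finite_measure_subalgebra "P y" "F (ennreal t)"
    using sets_F sets_P space_F space_P by unfold_locales (auto simp: subalgebra_def)
  have "(\<integral>\<omega>\<in>A. f (X (t + s) \<omega>) \<partial>P y)
      = (\<integral>\<omega>\<in>A. real_cond_exp (P y) (F (ennreal t)) (\<lambda>\<omega>. f (X (t + s) \<omega>)) \<omega> \<partial>P y)"
    using t f A by (intro S.real_cond_exp_intA integrable_comp_X) auto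
  also have "\<dots> = (\<integral>\<omega>\<in>A. Pt s f (X t \<omega>) \<partial>P y)"
  proof (rule set_lebesgue_integral_cong_AE)
    show "A \<in> sets (P y)" using A sets_F sets_P by auto
    show "(\<lambda>\<omega>. Pt s f (X t \<omega>)) \<in> borel_measurable (P y)"
      using measurable_comp_X[OF t(1) op_bcontfun'[OF t(2) f]] by (simp add: measurable_cong_sets[OF sets_P refl])
    show "AE \<omega>\<in>A in P y. real_cond_exp (P y) (F (ennreal t)) (\<lambda>\<omega>. f (X (t + s) \<omega>)) \<omega> = Pt s f (X t \<omega>)"
    proof -
      have "AE \<omega> in P y. real_cond_exp (P y) (F (ennreal t)) (\<lambda>\<omega>. f (X (t + s) \<omega>)) \<omega> = Pt s f (X t \<omega>)"
        using t f by (rule markov_conditional)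
      then show ?thesis by (rule eventually_mono) simp
    qed
  qed auto
  finally show ?thesis .
qed

lemma semigroup:
  assumes t: "0 \<le> t" "0 \<le> s" and f: "f \<in> bcontfun"
  shows "Pt (t + s) f y = Pt t (Pt s f) (y :: 'e)"
proof -
  have "space M \<in> sets (F (ennreal t))" using sets.top[of "F (ennreal t)"] space_F by simp
  from markov_on_set[OF this t f, of y] show ?thesis
    using set_integral_space[OF integrable_comp_X[of "t + s" f y]]
      set_integral_space[OF integrable_comp_X[of t "Pt s f" y]] t f op_bcontfun'[of s f]
    by (simp add: transition_op_def space_P)
qed

lemma right_continuous_path:
  assumes f: "(f :: 'e \<Rightarrow> real) \<in> bcontfun" and "0 \<le> t" "\<omega> \<in> space M"
  shows "continuous (at_right t) (\<lambda>s. f (X s \<omega>))"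
proof -
  have "((\<lambda>s. X s \<omega>) \<longlongrightarrow> X t \<omega>) (at_right t)"
    using paths[OF assms(3,2)] by (simp add: continuous_within)
  moreover have "isCont f (X t \<omega>)"
    using f by (simp add: bcontfun_def continuous_on_eq_continuous_at)
  ultimately have "((\<lambda>s. f (X s \<omega>)) \<longlongrightarrow> f (X t \<omega>)) (at_right t)"
    by (rule isCont_tendsto_compose[rotated])
  then show ?thesis
    by (simp only: continuous_within)
qed

lemma right_continuous_semigroup:
  assumes f: "(f :: 'e \<Rightarrow> real) \<in> bcontfun" and t: "0 \<le> t"
  shows "continuous (at_right t) (\<lambda>s. Pt s f y)"
proof -
  interpret prob_space "P y" by (rule prob_space_P)
  obtain B where B: "\<And>y. \<bar>f y\<bar> \<le> B" using bcontfun_bound[OF f] by metis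
  have seq: "(\<lambda>n. Pt (u n) f y) \<longlonglongrightarrow> Pt t f y"
    if u: "filterlim u (at_right t) sequentially" "\<And>n. t < u n" for u :: "nat \<Rightarrow> real"
    unfolding transition_op_def
  proof (rule integral_dominated_convergence[where w="\<lambda>_. B"])
    show "(\<lambda>\<omega>. f (X (u n) \<omega>)) \<in> borel_measurable (P y)" for n
      using measurable_comp_X[of "u n" f] u(2)[of n] t f by (simp add: measurable_cong_sets[OF sets_P refl])
    show "(\<lambda>\<omega>. f (X t \<omega>)) \<in> borel_measurable (P y)"
      using measurable_comp_X[of t f] t f by (simp add: measurable_cong_sets[OF sets_P refl])
    show "AE \<omega> in P y. (\<lambda>n. f (X (u n) \<omega>)) \<longlonglongrightarrow> f (X t \<omega>)"
    proof (rule AE_I2)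
      fix \<omega> assume "\<omega> \<in> space (P y)"
      then have "((\<lambda>s. f (X s \<omega>)) \<longlongrightarrow> f (X t \<omega>)) (at_right t)"
        using right_continuous_path[OF f t] by (simp add: continuous_within space_P)
      then show "(\<lambda>n. f (X (u n) \<omega>)) \<longlonglongrightarrow> f (X t \<omega>)"
        using u(1) by (rule filterlim_compose)
    qed
  qed (auto simp: B)
  show ?thesis
    unfolding continuous_within
  proof (rule tendsto_at_right_sequentially[of t "t + 1"])
    fix S :: "nat \<Rightarrow> real" assume S: "\<And>n. t < S n" "S \<longlonglongrightarrow> t"
    have "filterlim S (at_right t) sequentially"
      unfolding filterlim_at using S by (auto simp: less_imp_neq[symmetric])
    then show "(\<lambda>n. Pt (S n) f y) \<longlonglongrightarrow> Pt t f y"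
      using S(1) by (rule seq)
  qed simp
qed

lemma semigroup_jointly_measurable:
  assumes f: "(f :: 'e \<Rightarrow> real) \<in> bcontfun"
  shows "(\<lambda>(s, y). Pt (max 0 s) f y) \<in> borel_measurable (borel \<Otimes>\<^sub>M borel)"
proof (rule right_continuous_jointly_measurable[of "\<lambda>s. Pt s f" borel])
  fix s :: real assume "0 < s"
  then show "Pt s f \<in> borel_measurable borel"
    using f by (intro bcontfun_borel_measurable op_bcontfun)
next
  fix s :: real and y :: 'e assume "0 \<le> s"
  with f show "continuous (at_right s) (\<lambda>s. Pt s f y)"
    by (rule right_continuous_semigroup)
qed

end

section \<open>Strong continuity of the semigroup\<close>

context compact_feller_process
begin

lemma continuous_op: "0 \<le> t \<Longrightarrow> f \<in> bcontfun \<Longrightarrow> isCont (Pt t f) y"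
  using op_bcontfun'[of t f] by (simp add: bcontfun_def continuous_on_eq_continuous_at)

text \<open>
  Supermedian functions are the substitute for the domain of the generator. Discounted at rate
  \<open>l\<close>, the function \<open>t \<mapsto> exp (- l t) P\<^sub>t h\<close> is decreasing (lemma \<open>supermedian_antimono\<close>), so a lower
  bound at a single positive time, where the Feller property gives continuity in the space variable,
  is a lower bound at all earlier times. Unlike the domain of the generator, the class is closed
  under minima.
\<close>

definition supermedian :: "real \<Rightarrow> ('e \<Rightarrow> real) \<Rightarrow> bool" where
  "supermedian l h \<longleftrightarrow> h \<in> bcontfun \<and> (\<forall>z. 0 \<le> h z) \<and> (\<forall>t\<ge>0. \<forall>z. exp (- l * t) * Pt t h z \<le> h z)"

lemma supermedian_const: "0 \<le> K \<Longrightarrow> supermedian 0 (\<lambda>_. K)"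
  by (simp add: supermedian_def const_bcontfun op_const)

lemma op_nonneg:
  assumes "0 \<le> t" "f \<in> bcontfun" "\<And>z. 0 \<le> f z" shows "0 \<le> Pt t f y"
  using op_mono[of t "\<lambda>_. 0" f y] assms by (simp add: op_const const_bcontfun)

lemma supermedian_mono:
  assumes "supermedian l h" "l \<le> m" shows "supermedian m h"
  unfolding supermedian_def
proof (intro conjI allI impI)
  fix t :: real and z assume t: "0 \<le> t"
  have h: "h \<in> bcontfun" "\<And>z. 0 \<le> h z" and le: "exp (- l * t) * Pt t h z \<le> h z"
    using assms t by (auto simp: supermedian_def)
  have "exp (- m * t) \<le> exp (- l * t)" using assms t by (simp add: mult_right_mono)
  then have "exp (- m * t) * Pt t h z \<le> exp (- l * t) * Pt t h z"
    using op_nonneg[OF t h] by (rule mult_right_mono)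
  with le show "exp (- m * t) * Pt t h z \<le> h z" by simp
qed (use assms in \<open>auto simp: supermedian_def\<close>)

lemma supermedian_min:
  assumes "supermedian l h" "supermedian l k" shows "supermedian l (\<lambda>z. min (h z) (k z))"
proof -
  let ?m = "\<lambda>z. min (h z) (k z)"
  have bc: "?m \<in> bcontfun"
    using assms compact_space by (intro bcontfun_compact continuous_on_min) (auto simp: supermedian_def bcontfun_def)
  have "exp (- l * t) * Pt t ?m z \<le> ?m z" if t: "0 \<le> t" for t z
  proof -
    have "Pt t ?m z \<le> Pt t h z" "Pt t ?m z \<le> Pt t k z"
      using assms bc t by (auto simp: supermedian_def intro!: op_mono)
    then have "exp (- l * t) * Pt t ?m z \<le> exp (- l * t) * Pt t h z" "exp (- l * t) * Pt t ?m z \<le> exp (- l * t) * Pt t k z"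
      by simp_all
    moreover have "exp (- l * t) * Pt t h z \<le> h z" "exp (- l * t) * Pt t k z \<le> k z"
      using assms t by (auto simp: supermedian_def)
    ultimately show ?thesis by (intro min.boundedI) (meson order_trans)+
  qed
  then show ?thesis using bc assms by (auto simp: supermedian_def)
qed

lemma supermedian_antimono:
  assumes h: "supermedian l h" and t: "0 \<le> t" "t \<le> u"
  shows "exp (- l * u) * Pt u h z \<le> exp (- l * t) * Pt t h z"
proof -
  define s where "s = u - t"
  have s: "0 \<le> s" "u = t + s" using t by (auto simp: s_def)
  have hb: "h \<in> bcontfun" and le: "\<And>z. exp (- l * s) * Pt s h z \<le> h z" using h s by (auto simp: supermedian_def)
  have "exp (- l * u) * Pt u h z = exp (- l * t) * (exp (- l * s) * Pt t (Pt s h) z)"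
    using semigroup[OF t(1) s(1) hb] by (simp add: s(2) exp_add[symmetric] algebra_simps)
  also have "exp (- l * s) * Pt t (Pt s h) z = Pt t (\<lambda>z. exp (- l * s) * Pt s h z) z"
    using op_add_const[OF t(1) op_bcontfun'[OF s(1) hb], of "exp (- l * s)" 0] by simp
  also have "\<dots> \<le> Pt t h z"
    using op_bcontfun'[OF s(1) hb] compact_space
    by (intro op_mono t hb le bcontfun_compact) (auto simp: bcontfun_def intro!: continuous_intros)
  finally show ?thesis by simp
qed

text \<open>
  The normalised resolvent \<open>\<lambda> R\<^sub>\<lambda> f\<close> with \<open>\<lambda> = 1 / a\<close>, that is, \<open>\<lambda> \<integral>\<^sub>0\<^sup>\<infinity> exp (- \<lambda> t) P\<^sub>t f dt\<close>
  after the substitution \<open>t = a u\<close>. In this form the weight does not depend on \<open>a\<close>, and the limit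
  \<open>a \<longlongrightarrow> 0\<close> is a matter of dominated convergence.
\<close>

definition potential :: "real \<Rightarrow> ('e \<Rightarrow> real) \<Rightarrow> 'e \<Rightarrow> real" where
  "potential a f y = (\<integral>u. exp (- u) * indicator {0..} u * Pt (max 0 (a * u)) f y \<partial>lborel)"

lemma exp_weight:
  "integrable lborel (\<lambda>u::real. exp (- u) * indicator {0..} u)"
  "(\<integral>u. exp (- u) * indicator {0..} u \<partial>lborel) = (1 :: real)"
  using has_bochner_integral_I0i_power_exp_m'[of 0] by (auto simp: has_bochner_integral_iff)

lemma potential_measurable:
  assumes f: "f \<in> bcontfun"
  shows "(\<lambda>u. exp (- u) * indicator {0..} u * Pt (max 0 (a * u)) f y) \<in> borel_measurable lborel"
proof -
  have "(\<lambda>u::real. (a * u, y)) \<in> borel \<rightarrow>\<^sub>M borel \<Otimes>\<^sub>M borel" by measurable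
  from measurable_compose[OF this semigroup_jointly_measurable[OF f]]
  have [measurable]: "(\<lambda>u. Pt (max 0 (a * u)) f y) \<in> borel_measurable borel" by simp
  show ?thesis by measurable
qed

lemma potential_dominated:
  assumes f: "f \<in> bcontfun" and B: "\<And>z. \<bar>f z\<bar> \<le> B"
  shows "norm (exp (- u) * indicator {0..} u * Pt (max 0 (a * u)) f y) \<le> B * (exp (- u) * indicator {0..} u)"
  using op_bounded[OF _ f B, of "max 0 (a * u)" y]
  by (simp add: abs_mult mult.commute mult_left_mono split: split_indicator)

lemma potential_integrable:
  assumes f: "f \<in> bcontfun"
  shows "integrable lborel (\<lambda>u. exp (- u) * indicator {0..} u * Pt (max 0 (a * u)) f y)"
proof -
  obtain B where B: "\<And>z. \<bar>f z\<bar> \<le> B" "0 \<le> B" using bcontfun_bound[OF f] by metis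
  show ?thesis
  proof (rule Bochner_Integration.integrable_bound)
    show "integrable lborel (\<lambda>u. B * (exp (- u) * indicator {0..} u))"
      using exp_weight(1) by simp
    show "AE u in lborel. norm (exp (- u) * indicator {0..} u * Pt (max 0 (a * u)) f y)
        \<le> norm (B * (exp (- u) * indicator {0..} u))"
      using order_trans[OF potential_dominated[OF f B(1)] abs_ge_self] by (intro AE_I2) simp
  qed (rule potential_measurable[OF f])
qed

lemma potential_bcontfun:
  assumes f: "f \<in> bcontfun" shows "potential a f \<in> bcontfun"
proof -
  obtain B where B: "\<And>z. \<bar>f z\<bar> \<le> B" "0 \<le> B" using bcontfun_bound[OF f] by metis
  have "(\<lambda>n. potential a f (v n)) \<longlonglongrightarrow> potential a f y" if v: "v \<longlonglongrightarrow> y" for v y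
    unfolding potential_def
  proof (rule integral_dominated_convergence[where w="\<lambda>u. B * (exp (- u) * indicator {0..} u)"])
    show "AE u in lborel. (\<lambda>n. exp (- u) * indicator {0..} u * Pt (max 0 (a * u)) f (v n))
        \<longlonglongrightarrow> exp (- u) * indicator {0..} u * Pt (max 0 (a * u)) f y"
      using isCont_tendsto_compose[OF continuous_op[OF _ f] v] by (intro AE_I2 tendsto_mult tendsto_const) simp
    show "integrable lborel (\<lambda>u. B * (exp (- u) * indicator {0..} u))"
      using exp_weight(1) by simp
  qed ((rule potential_measurable[OF f])+, rule AE_I2, rule potential_dominated[OF f B(1)])
  then have "continuous_on UNIV (potential a f)"
    by (auto simp: continuous_on_sequentially o_def)
  with compact_space show ?thesis by (rule bcontfun_compact)
qed

lemma potential_tendsto: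
  assumes f: "f \<in> bcontfun" and a: "a \<longlonglongrightarrow> 0" "\<And>n. 0 < a n"
  shows "(\<lambda>n. potential (a n) f y) \<longlonglongrightarrow> f y"
proof -
  obtain B where B: "\<And>z. \<bar>f z\<bar> \<le> B" "0 \<le> B" using bcontfun_bound[OF f] by metis
  have "(\<lambda>n. potential (a n) f y) \<longlonglongrightarrow> (\<integral>u. exp (- u) * indicator {0..} u * f y \<partial>lborel)"
    unfolding potential_def
  proof (rule integral_dominated_convergence[where w="\<lambda>u. B * (exp (- u) * indicator {0..} u)"])
    show "integrable lborel (\<lambda>u. B * (exp (- u) * indicator {0..} u))"
      using exp_weight(1) by simp
    show "AE u in lborel. (\<lambda>n. exp (- u) * indicator {0..} u * Pt (max 0 (a n * u)) f y)
        \<longlonglongrightarrow> exp (- u) * indicator {0..} u * f y"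
    proof (rule AE_I2)
      fix u :: real
      consider "u < 0" | "u = 0" | "0 < u" by linarith
      then show "(\<lambda>n. exp (- u) * indicator {0..} u * Pt (max 0 (a n * u)) f y)
        \<longlonglongrightarrow> exp (- u) * indicator {0..} u * f y"
      proof cases
        case 3
        have "(\<lambda>n. a n * u) \<longlonglongrightarrow> 0" using tendsto_mult_right[OF a(1), of u] by simp
        then have lim: "filterlim (\<lambda>n. a n * u) (at_right 0) sequentially"
          unfolding filterlim_at using a(2) 3 by (auto simp: less_imp_neq[symmetric])
        have "((\<lambda>s. Pt s f y) \<longlongrightarrow> f y) (at_right 0)"
          using right_continuous_semigroup[OF f, of 0 y] op_zero[OF f] by (simp add: continuous_within)
        from filterlim_compose[OF this lim] have "(\<lambda>n. Pt (a n * u) f y) \<longlonglongrightarrow> f y" .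
        moreover have "max 0 (a n * u) = a n * u" for n using a(2)[of n] 3 by simp
        ultimately show ?thesis by (simp only: tendsto_mult_left)
      qed (auto simp: op_zero[OF f])
    qed
    show "(\<lambda>u. exp (- u) * indicator {0..} u * f y) \<in> borel_measurable lborel"
      by measurable
  qed (rule potential_measurable[OF f], rule AE_I2, rule potential_dominated[OF f B(1)])
  moreover have "(\<integral>u. exp (- u) * indicator {0..} u * f y \<partial>lborel) = f y"
    unfolding integral_mult_left_zero exp_weight(2) by simp
  ultimately show ?thesis by (simp only:)
qed

lemma op_potential:
  assumes f: "f \<in> bcontfun" and t: "0 \<le> t" and a: "0 < a"
  shows "Pt t (potential a f) y = (\<integral>u. exp (- u) * indicator {0..} u * Pt (max 0 (a * u + t)) f y \<partial>lborel)"
proof -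
  obtain B where B: "\<And>z. \<bar>f z\<bar> \<le> B" "0 \<le> B" using bcontfun_bound[OF f] by metis
  interpret prob_space "P y" by (rule prob_space_P)
  interpret pair_sigma_finite lborel "P y" ..
  let ?k = "\<lambda>u \<omega>. exp (- u) * indicator {0..} u * Pt (max 0 (a * u)) f (X t \<omega>)"
  have Xm: "X t \<in> borel_measurable (P y)"
    using X_measurable[OF t] by (simp add: measurable_cong_sets[OF sets_P refl])
  have "(\<lambda>p. (a * fst p, X t (snd p))) \<in> lborel \<Otimes>\<^sub>M P y \<rightarrow>\<^sub>M borel \<Otimes>\<^sub>M borel"
    using Xm by measurable
  from measurable_compose[OF this semigroup_jointly_measurable[OF f]]
  have [measurable]: "(\<lambda>p. Pt (max 0 (a * fst p)) f (X t (snd p))) \<in> borel_measurable (lborel \<Otimes>\<^sub>M P y)" by simp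
  have "integrable (lborel \<Otimes>\<^sub>M P y) (\<lambda>p. B * (exp (- fst p) * indicator {0..} (fst p)))"
    using integrable_product_swap
    by (intro integrable_mult_right Fubini_integrable)
      (use exp_weight(1) in \<open>auto simp: prob_space\<close>)
  then have int: "integrable (lborel \<Otimes>\<^sub>M P y) (case_prod ?k)"
  proof (rule Bochner_Integration.integrable_bound)
    show "AE p in lborel \<Otimes>\<^sub>M P y. norm (case_prod ?k p) \<le> norm (B * (exp (- fst p) * indicator {0..} (fst p)))"
      using order_trans[OF potential_dominated[OF f B(1)] abs_ge_self] by (intro AE_I2) (simp add: split_beta')
  qed (simp add: split_beta')
  have "Pt t (potential a f) y = (\<integral>\<omega>. (\<integral>u. ?k u \<omega> \<partial>lborel) \<partial>P y)"
    by (simp add: transition_op_def[of _ _ t] potential_def)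
  also have "\<dots> = (\<integral>u. (\<integral>\<omega>. ?k u \<omega> \<partial>P y) \<partial>lborel)"
    by (rule Fubini_integral[OF int])
  also have "\<dots> = (\<integral>u. exp (- u) * indicator {0..} u * Pt (max 0 (a * u + t)) f y \<partial>lborel)"
  proof (rule Bochner_Integration.integral_cong)
    fix u :: real
    show "(\<integral>\<omega>. ?k u \<omega> \<partial>P y) = exp (- u) * indicator {0..} u * Pt (max 0 (a * u + t)) f y"
    proof (cases "0 \<le> u")
      case True
      then have au: "0 \<le> a * u" using a by simp
      have "(\<integral>\<omega>. ?k u \<omega> \<partial>P y) = exp (- u) * indicator {0..} u * Pt t (Pt (a * u) f) y"
        using au by (simp add: transition_op_def[of _ _ t])
      also have "Pt t (Pt (a * u) f) y = Pt (max 0 (a * u + t)) f y"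
        using semigroup[OF t au f, of y] au t by (simp add: add.commute)
      finally show ?thesis .
    qed simp
  qed simp
  finally show ?thesis .
qed

lemma potential_nonneg:
  assumes f: "f \<in> bcontfun" "\<And>z. 0 \<le> f z" shows "0 \<le> potential a f y"
  unfolding potential_def using op_nonneg[OF _ f] by (intro integral_nonneg_AE AE_I2) simp

text \<open>
  Applying \<open>P\<^sub>t\<close> and discounting shifts the integration variable by \<open>t / a\<close>, which merely cuts off
  the part of the integral below \<open>t / a\<close>.
\<close>

lemma potential_supermedian:
  assumes f: "f \<in> bcontfun" "\<And>z. 0 \<le> f z" and a: "0 < a"
  shows "supermedian (1 / a) (potential a f)"
  unfolding supermedian_def
proof (intro conjI allI impI)
  fix t :: real and y assume t: "0 \<le> t"
  let ?k = "\<lambda>v. exp (- v) * indicator {0..} v * Pt (max 0 (a * v)) f y"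
  let ?l = "\<lambda>v. exp (- v) * indicator {t / a..} v * Pt (max 0 (a * v)) f y"
  have le: "?l v \<le> ?k v" for v
    using op_nonneg[OF _ f, of "max 0 (a * v)" y] t a
    by (auto split: split_indicator intro: order_trans[of 0 "t / a"])
  have l0: "0 \<le> ?l v" for v
    using op_nonneg[OF _ f, of "max 0 (a * v)" y] by simp
  have int: "integrable lborel ?l"
  proof (rule Bochner_Integration.integrable_bound[OF potential_integrable[OF f(1)]])
    have "(\<lambda>u::real. (a * u, y)) \<in> borel \<rightarrow>\<^sub>M borel \<Otimes>\<^sub>M borel" by measurable
    from measurable_compose[OF this semigroup_jointly_measurable[OF f(1)]]
    have [measurable]: "(\<lambda>u. Pt (max 0 (a * u)) f y) \<in> borel_measurable borel" by simp
    show "?l \<in> borel_measurable lborel" by measurable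
    show "AE v in lborel. norm (?l v) \<le> norm (?k v)"
      using le l0 order_trans[OF l0 le] by (intro AE_I2) (simp only: real_norm_def abs_of_nonneg)
  qed
  have "exp (- (1 / a) * t) * Pt t (potential a f) y
      = (\<integral>u. exp (- (1 / a) * t) * (exp (- u) * indicator {0..} u * Pt (max 0 (a * u + t)) f y) \<partial>lborel)"
    unfolding op_potential[OF f(1) t a] by simp
  also have "\<dots> = (\<integral>u. ?l (t / a + 1 * u) \<partial>lborel)"
  proof (rule Bochner_Integration.integral_cong)
    fix u :: real
    have "a * (t / a + 1 * u) = a * u + t" using a by (simp add: field_simps)
    moreover have "exp (- (t / a + 1 * u)) = exp (- (1 / a) * t) * exp (- u)" by (simp add: exp_add[symmetric])
    moreover have "indicator {t / a..} (t / a + 1 * u) = (indicator {0..} u :: real)" by (simp split: split_indicator)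
    ultimately show "exp (- (1 / a) * t) * (exp (- u) * indicator {0..} u * Pt (max 0 (a * u + t)) f y) = ?l (t / a + 1 * u)"
      by (simp only: mult.assoc)
  qed simp
  also have "\<dots> = (\<integral>v. ?l v \<partial>lborel)"
    using lborel_integral_real_affine[of 1 ?l "t / a"] by simp
  also have "\<dots> \<le> potential a f y"
    unfolding potential_def by (intro integral_mono int potential_integrable[OF f(1)] le)
  finally show "exp (- (1 / a) * t) * Pt t (potential a f) y \<le> potential a f y" .
qed (use potential_nonneg[OF f] potential_bcontfun[OF f(1)] in auto)

text \<open>
  Potentials converge to \<open>f\<close> pointwise as \<open>a \<longlongrightarrow> 0\<close>, so near each \<open>z\<close> some potential lies below \<open>f + d\<close> and still exceeds
  \<open>f - d\<close> at \<open>y\<close>. Finitely many such neighbourhoods cover the space, and the minimum of the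
  corresponding potentials is again supermedian.
\<close>

lemma supermedian_approximation:
  assumes f: "f \<in> bcontfun" "\<And>z. 0 \<le> f z" and d: "0 < d"
  obtains l h where "supermedian l h" "f y - d < h y" "\<And>z. h z < f z + d"
proof -
  have "\<exists>a>0. f y - d < potential a f y \<and> potential a f z < f z + d" for z
  proof -
    let ?a = "\<lambda>n. inverse (real (Suc n))"
    have lim: "(\<lambda>n. potential (?a n) f v) \<longlonglongrightarrow> f v" for v
      by (rule potential_tendsto[OF f(1) LIMSEQ_inverse_real_of_nat]) simp
    have "\<forall>\<^sub>F n in sequentially. f y - d < potential (?a n) f y"
      by (rule order_tendstoD(1)[OF lim]) (use d in simp)
    moreover have "\<forall>\<^sub>F n in sequentially. potential (?a n) f z < f z + d"
      by (rule order_tendstoD(2)[OF lim]) (use d in simp)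
    ultimately have "\<forall>\<^sub>F n in sequentially. f y - d < potential (?a n) f y \<and> potential (?a n) f z < f z + d"
      by (rule eventually_conj)
    then obtain n where "f y - d < potential (?a n) f y \<and> potential (?a n) f z < f z + d"
      using eventually_happens' trivial_limit_sequentially by blast
    then show ?thesis by (intro exI[of _ "?a n"]) simp
  qed
  then obtain a where a: "\<And>z. 0 < a z" "\<And>z. f y - d < potential (a z) f y" "\<And>z. potential (a z) f z < f z + d"
    by metis
  define N where "N z = {v. potential (a z) f v < f v + d}" for z
  have "open (N z)" for z
    unfolding N_def using potential_bcontfun[OF f(1), of "a z"] f(1)
    by (intro open_Collect_less) (auto simp: bcontfun_def intro!: continuous_intros)
  moreover have "z \<in> N z" for z using a(3) by (simp add: N_def)
  ultimately obtain Z where Z: "finite Z" "UNIV \<subseteq> (\<Union>z\<in>Z. N z)"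
    using compactE_image[OF compact_space, of UNIV N] by (metis UNIV_I UN_I subsetI)
  have "\<exists>l h. supermedian l h \<and> f y - d < h y \<and> (\<forall>v\<in>(\<Union>z\<in>Z'. N z). h v < f v + d)" if "finite Z'" for Z'
    using that
  proof induction
    case empty
    show ?case using supermedian_const[of "f y"] f(2) d by (intro exI[of _ 0] exI[of _ "\<lambda>_. f y"]) auto
  next
    case (insert z Z')
    then obtain l h where h: "supermedian l h" "f y - d < h y" "\<And>v. v \<in> (\<Union>z\<in>Z'. N z) \<Longrightarrow> h v < f v + d"
      by blast
    let ?l = "max l (1 / a z)" and ?h = "\<lambda>v. min (h v) (potential (a z) f v)"
    have "supermedian ?l ?h"
      using supermedian_mono[OF h(1), of ?l] supermedian_mono[OF potential_supermedian[OF f a(1)[of z]], of ?l]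
      by (intro supermedian_min) auto
    moreover have "f y - d < ?h y" using h(2) a(2)[of z] by simp
    moreover have "?h v < f v + d" if "v \<in> (\<Union>z\<in>insert z Z'. N z)" for v
      using that h(3)[of v] by (auto simp: N_def min_less_iff_disj)
    ultimately show ?case by blast
  qed
  from this[OF Z(1)] obtain l h where "supermedian l h" "f y - d < h y" "\<forall>v\<in>(\<Union>z\<in>Z. N z). h v < f v + d"
    by blast
  with Z(2) that show thesis by blast
qed

text \<open>
  With \<open>h\<close> supermedian at a rate \<open>l \<ge> 0\<close>, below \<open>f + d\<close> everywhere and above \<open>f - d\<close> at \<open>y\<close>, monotonicity gives
  \<open>P\<^sub>t f + d \<ge> P\<^sub>t h \<ge> exp (- l t) P\<^sub>t h \<ge> exp (- l s) P\<^sub>s h\<close> for \<open>t \<le> s\<close>. The last function is continuous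
  and, for small \<open>s\<close>, exceeds \<open>f y - d\<close> at \<open>y\<close>, hence near \<open>y\<close>. Compactness makes the choice of \<open>s\<close>
  uniform.
\<close>

lemma semigroup_lower_bound:
  assumes f: "f \<in> bcontfun" "\<And>z. 0 \<le> f z" and e: "0 < e"
  obtains t0 where "0 < t0" "\<And>t z. 0 \<le> t \<Longrightarrow> t \<le> t0 \<Longrightarrow> f z - e \<le> Pt t f z"
proof -
  \<comment> \<open>three errors of size \<open>d\<close> are made below: in \<open>h < f + d\<close>, in \<open>f y - d < exp (- l s) P\<^sub>s h\<close>, and in \<open>f z < f y + d\<close>\<close>
  define d where "d = e / 3"
  have d: "0 < d" using e by (simp add: d_def)
  have "\<exists>U s. open U \<and> y \<in> U \<and> 0 < s \<and> (\<forall>z\<in>U. \<forall>t. 0 \<le> t \<and> t \<le> s \<longrightarrow> f z - e \<le> Pt t f z)" for y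
  proof -
    obtain l h where h: "supermedian l h" "f y - d < h y" "\<And>z. h z < f z + d"
      using supermedian_approximation[OF f d] by metis
    have hb: "h \<in> bcontfun" and h0: "\<And>z. 0 \<le> h z" using h(1) by (auto simp: supermedian_def)
    let ?q = "\<lambda>s z. exp (- max 0 l * s) * Pt s h z"
    have sm: "supermedian (max 0 l) h" using h(1) by (rule supermedian_mono) simp
    have "((\<lambda>s. ?q s y) \<longlongrightarrow> exp (- max 0 l * 0) * Pt 0 h y) (at_right 0)"
      using right_continuous_semigroup[OF hb, of 0 y]
      by (intro tendsto_mult) (auto simp: continuous_within intro!: tendsto_eq_intros)
    then have "((\<lambda>s. ?q s y) \<longlongrightarrow> h y) (at_right 0)" by (simp add: op_zero[OF hb])
    then have "\<forall>\<^sub>F s in at_right 0. f y - d < ?q s y" using h(2) by (rule order_tendstoD)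
    then obtain s where s: "0 < s" "f y - d < ?q s y"
      unfolding eventually_at_right[OF zero_less_one] by (meson dense)
    define U where "U = {z. f y - d < ?q s z \<and> f z < f y + d}"
    have "open U"
      unfolding U_def using op_bcontfun[OF s(1) hb] f(1)
      by (intro open_Collect_conj open_Collect_less) (auto simp: bcontfun_def intro!: continuous_intros)
    moreover have "y \<in> U" using s d by (simp add: U_def)
    moreover have "f z - e \<le> Pt t f z" if z: "z \<in> U" and t: "0 \<le> t" "t \<le> s" for z t
    proof -
      have "Pt t h z \<le> Pt t (\<lambda>z. 1 * f z + d) z"
        using h(3) f compact_space t hb
        by (intro op_mono bcontfun_compact) (auto simp: bcontfun_def less_imp_le intro!: continuous_intros)
      also have "\<dots> = Pt t f z + d" using op_add_const[OF t(1) f(1), of 1 d z] by simp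
      finally have "Pt t h z \<le> Pt t f z + d" .
      moreover have "?q t z \<le> 1 * Pt t h z"
        using op_nonneg[OF t(1) hb h0, of z] t by (intro mult_right_mono) auto
      moreover have "?q s z \<le> ?q t z" using supermedian_antimono[OF sm t] .
      ultimately show ?thesis using z e unfolding U_def mem_Collect_eq d_def by linarith
    qed
    ultimately show ?thesis using s(1) by blast
  qed
  then obtain U s where U: "\<And>y. open (U y)" "\<And>y. y \<in> U y" "\<And>y. (0::real) < s y"
      "\<And>y z t. z \<in> U y \<Longrightarrow> 0 \<le> t \<Longrightarrow> t \<le> s y \<Longrightarrow> f z - e \<le> Pt t f z" by metis
  obtain Z where Z: "finite Z" "UNIV \<subseteq> (\<Union>z\<in>Z. U z)"
    using compactE_image[OF compact_space, of UNIV U] U(1,2) by (metis UNIV_I UN_I subsetI)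
  define t0 where "t0 = Min (insert 1 (s ` Z))"
  have "0 < t0" using Z(1) U(3) by (simp add: t0_def)
  moreover have "f z - e \<le> Pt t f z" if "0 \<le> t" "t \<le> t0" for t z
  proof -
    obtain y where y: "y \<in> Z" "z \<in> U y" using Z(2) by blast
    have "t0 \<le> s y" using y(1) Z(1) by (simp add: t0_def)
    with that y U(4)[of z y t] show ?thesis by simp
  qed
  ultimately show thesis using that by blast
qed

text \<open>
  The one-sided bound for the nonnegative functions \<open>B + f\<close> and \<open>B - f\<close> is two-sided for \<open>f\<close>, because
  \<open>P\<^sub>t\<close> preserves constants.
\<close>

lemma semigroup_strongly_continuous:
  assumes f: "f \<in> bcontfun" and e: "0 < e"
  obtains t0 where "0 < t0" "\<And>t z. 0 \<le> t \<Longrightarrow> t \<le> t0 \<Longrightarrow> \<bar>Pt t f z - f z\<bar> \<le> e"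
proof -
  obtain B where B: "\<And>z. \<bar>f z\<bar> \<le> B" using bcontfun_bound[OF f] by metis
  have bc: "(\<lambda>z. s * f z + B) \<in> bcontfun" for s
    using f compact_space by (intro bcontfun_compact) (auto simp: bcontfun_def intro!: continuous_intros)
  have "0 \<le> 1 * f z + B" "0 \<le> - 1 * f z + B" for z using B[of z] by auto
  with semigroup_lower_bound[OF bc _ e] obtain t1 t2 where
    t1: "0 < t1" "\<And>t z. 0 \<le> t \<Longrightarrow> t \<le> t1 \<Longrightarrow> (1 * f z + B) - e \<le> Pt t (\<lambda>z. 1 * f z + B) z" and
    t2: "0 < t2" "\<And>t z. 0 \<le> t \<Longrightarrow> t \<le> t2 \<Longrightarrow> (- 1 * f z + B) - e \<le> Pt t (\<lambda>z. - 1 * f z + B) z"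
    by metis
  show thesis
  proof (rule that[of "min t1 t2"])
    fix t z assume t: "0 \<le> t" "t \<le> min t1 t2"
    show "\<bar>Pt t f z - f z\<bar> \<le> e"
      using t1(2)[of t z] t2(2)[of t z] t op_add_const[OF t(1) f, of 1 B z] op_add_const[OF t(1) f, of "-1" B z]
      by (simp add: abs_le_iff)
  qed (use t1 t2 in simp)
qed

end

section \<open>The controlled process between grid times\<close>

text \<open>
  A strategy that acts at multiples of \<open>h\<close> only, together with its controlled law \<open>Q\<close>. For
  \<open>r < h\<close> no impulse falls strictly between \<open>i h\<close> and \<open>i h + r\<close>, so that the controlled process moves
  by the uncontrolled semigroup there.
\<close>

locale grid_controlled_process = compact_feller_process M F X P
  for M :: "'w measure" and F :: "ennreal \<Rightarrow> 'w measure"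
    and X :: "real \<Rightarrow> 'w \<Rightarrow> 'e::{metric_space, second_countable_topology}" and P :: "'e \<Rightarrow> 'w measure" +
  fixes h :: real and V :: "('w, 'e) strategy" and x :: 'e and Q :: "(nat \<Rightarrow> 'w) measure"
  assumes h: "0 < h" and grid: "V \<in> grid_strategies M F h" and law: "controlled_law M F X P x V Q"
begin

abbreviation "\<tau> \<equiv> imp_time V"
abbreviation "Y \<equiv> controlled_process X V"
abbreviation "\<Omega> \<equiv> path_product M"

lemma space_product_filtration: "space (product_filtration M F n t) = space \<Omega>"
  unfolding product_filtration_def path_product_def space_PiM
  by (intro PiE_cong) (simp add: space_F space_measure_of_conv)

text \<open>
  The coordinates from \<open>n\<close> on carry the trivial \<open>\<sigma>\<close>-field and generate nothing; only the first \<open>n\<close>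
  have to be tested.
\<close>

lemma sets_product_filtration_subset:
  assumes "space N = space \<Omega>" and "\<And>i A. i < n \<Longrightarrow> A \<in> sets (F t) \<Longrightarrow> {\<omega> \<in> space \<Omega>. \<omega> i \<in> A} \<in> sets N"
  shows "sets (product_filtration M F n t) \<subseteq> sets N"
  unfolding product_filtration_def
proof (rule sets_PiM_in_sets)
  show "space N = (\<Pi>\<^sub>E i\<in>UNIV. space (if i < n then F t else sigma (space M) {}))"
    using space_product_filtration[of n t] assms(1) by (simp add: product_filtration_def space_PiM)
  fix i A assume A: "A \<in> sets (if i < n then F t else sigma (space M) {})"
  show "{\<omega> \<in> space N. \<omega> i \<in> A} \<in> sets N"
  proof (cases "i < n")
    case True
    with A assms show ?thesis by simp
  next
    case False
    with A have "A = {} \<or> A = space M" by (simp add: sigma_sets_empty_eq)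
    moreover have "{\<omega> \<in> space N. \<omega> i \<in> space M} = space N"
      using assms(1) by (auto simp: path_product_def space_PiM)
    ultimately show ?thesis by auto
  qed
qed

lemma sets_product_filtration_mono:
  assumes "n \<le> m" "t \<le> u" shows "sets (product_filtration M F n t) \<subseteq> sets (product_filtration M F m u)"
proof (rule sets_product_filtration_subset)
  fix i A assume i: "i < n" and A: "A \<in> sets (F t)"
  have "A \<in> sets (F u)" using A filtration.sets_F_mono[OF filtration_F assms(2)] by auto
  then have "{\<omega> \<in> space (product_filtration M F m u). \<omega> i \<in> A} \<in> sets (product_filtration M F m u)"
    unfolding product_filtration_def using i assms(1) by (intro sets_Collect_single) auto
  then show "{\<omega> \<in> space \<Omega>. \<omega> i \<in> A} \<in> sets (product_filtration M F m u)"
    by (simp add: space_product_filtration)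
qed (rule space_product_filtration)

lemma sets_product_filtration: "sets (product_filtration M F n t) \<subseteq> sets \<Omega>"
proof (rule sets_product_filtration_subset)
  fix i A assume "A \<in> sets (F t)"
  then show "{\<omega> \<in> space \<Omega>. \<omega> i \<in> A} \<in> sets \<Omega>"
    unfolding path_product_def using sets_F by (intro sets_Collect_single) auto
qed simp

lemma filtration_product: "filtration (space \<Omega>) (product_filtration M F n)"
  by (rule filtration.intro) (auto simp: space_product_filtration intro: subsetD[OF sets_product_filtration_mono])

lemma prob_space_Q: "prob_space Q" and sets_Q: "sets Q = sets \<Omega>"
  using law by (simp_all add: controlled_law_def)

lemma space_Q: "space Q = space \<Omega>"
  using sets_Q by (rule sets_eq_imp_space_eq)

lemma measurable_Q: "measurable Q N = measurable \<Omega> N"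
  using sets_Q by (rule measurable_cong_sets) simp

text \<open>
  An event of the past of \<open>T\<close> equals its own part on \<open>T \<le> \<infinity>\<close> and therefore belongs to the field at
  time \<open>\<infinity>\<close>. Conditional expectations under \<open>Q\<close> require this inclusion.
\<close>

lemma subalgebra_pre_sigma: "subalgebra Q (product_pre_sigma M F n T)"
proof -
  have sub: "{A. \<forall>t. {\<omega> \<in> A. T \<omega> \<le> t} \<in> sets (product_filtration M F n t)} \<subseteq> sets \<Omega>"
  proof
    fix A assume "A \<in> {A. \<forall>t. {\<omega> \<in> A. T \<omega> \<le> t} \<in> sets (product_filtration M F n t)}"
    then have "{\<omega> \<in> A. T \<omega> \<le> \<infinity>} \<in> sets (product_filtration M F n \<infinity>)" by blast
    then show "A \<in> sets \<Omega>" using sets_product_filtration[of n \<infinity>] by auto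
  qed
  then have "sigma_sets (space \<Omega>) {A. \<forall>t. {\<omega> \<in> A. T \<omega> \<le> t} \<in> sets (product_filtration M F n t)} \<subseteq> sets \<Omega>"
    by (rule sets.sigma_sets_subset)
  moreover have "{A. \<forall>t. {\<omega> \<in> A. T \<omega> \<le> t} \<in> sets (product_filtration M F n t)} \<subseteq> Pow (space \<Omega>)"
    using sub sets.space_closed by (rule order_trans)
  ultimately show ?thesis
    by (simp add: subalgebra_def filtration.pre_sigma_def[OF filtration_product] sets_Q space_Q)
qed

lemma in_pre_sigma:
  assumes A: "\<And>t. {\<omega> \<in> A. T \<omega> \<le> t} \<in> sets (product_filtration M F n t)"
  shows "A \<in> sets (product_pre_sigma M F n T)"
proof -
  have "{A. \<forall>t. {\<omega> \<in> A. T \<omega> \<le> t} \<in> sets (product_filtration M F n t)} \<subseteq> Pow (space \<Omega>)"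
  proof
    fix B assume "B \<in> {A. \<forall>t. {\<omega> \<in> A. T \<omega> \<le> t} \<in> sets (product_filtration M F n t)}"
    then have "{\<omega> \<in> B. T \<omega> \<le> \<infinity>} \<in> sets (product_filtration M F n \<infinity>)" by blast
    then show "B \<in> Pow (space \<Omega>)"
      using sets.sets_into_space[of B "product_filtration M F n \<infinity>"] by (simp add: space_product_filtration)
  qed
  with A show ?thesis
    by (simp add: filtration.pre_sigma_def[OF filtration_product] sigma_sets.Basic)
qed

lemma stopping_imp: "stopping_time (product_filtration M F (Suc k)) (\<tau> k)"
  using grid by (simp add: grid_strategies_def strategies_def)

lemma imp_time_grid: "\<omega> \<in> space \<Omega> \<Longrightarrow> \<tau> k \<omega> = \<infinity> \<or> (\<exists>m::nat. \<tau> k \<omega> = ennreal (real m * h))"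
  using grid by (auto simp: grid_strategies_def)

lemma imp_time_measurable[measurable]: "\<tau> k \<in> borel_measurable \<Omega>"
  by (rule measurable_stopping_time[OF stopping_imp sets_product_filtration space_product_filtration])

lemma coordinate_measurable[measurable]: "(\<lambda>\<omega>. \<omega> k) \<in> \<Omega> \<rightarrow>\<^sub>M M"
  unfolding path_product_def by (rule measurable_component_singleton) simp

lemma path_jointly_measurable:
  assumes f: "(f :: 'e \<Rightarrow> real) \<in> bcontfun"
  shows "(\<lambda>(s, \<omega>). f (X (max 0 s) \<omega>)) \<in> borel_measurable (borel \<Otimes>\<^sub>M M)"
proof (rule right_continuous_jointly_measurable[of "\<lambda>s \<omega>. f (X s \<omega>)" M])
  fix s :: real assume "0 < s"
  then show "(\<lambda>\<omega>. f (X s \<omega>)) \<in> borel_measurable M"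
    using f by (intro measurable_comp_X) auto
next
  fix s :: real and \<omega> assume "0 \<le> s" "\<omega> \<in> space M"
  with f show "continuous (at_right s) (\<lambda>s. f (X s \<omega>))"
    by (rule right_continuous_path)
qed

lemma coordinate_path_measurable:
  assumes f: "(f :: 'e \<Rightarrow> real) \<in> bcontfun" and T: "T \<in> borel_measurable \<Omega>"
  shows "(\<lambda>\<omega>. f (X (max 0 (T \<omega>)) (\<omega> k))) \<in> borel_measurable \<Omega>"
proof -
  have "(\<lambda>\<omega>. (T \<omega>, \<omega> k)) \<in> \<Omega> \<rightarrow>\<^sub>M borel \<Otimes>\<^sub>M M" using T by measurable
  from measurable_compose[OF this path_jointly_measurable[OF f]] show ?thesis by simp
qed

lemma integrable_bounded_Q:
  assumes "f \<in> borel_measurable \<Omega>" "\<And>\<omega>. \<bar>f \<omega>\<bar> \<le> (B::real)" shows "integrable Q f"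
proof -
  interpret prob_space Q by (rule prob_space_Q)
  show ?thesis using assms by (intro integrable_const_bound[of _ B]) (auto simp: measurable_Q)
qed

text \<open>
  The conditional Markov property holds at the random times \<open>\<tau> k + t\<close>. On an event on which
  \<open>\<tau> k\<close> has the fixed value \<open>m h\<close>, the choice \<open>t = (i - m) h\<close> turns it into a statement about the
  deterministic time \<open>i h\<close>.
\<close>

lemma markov_next_coordinate:
  assumes A: "A \<in> sets (product_filtration M F (Suc (Suc k)) (ennreal (real i * h)))"
    and last: "\<And>\<omega>. \<omega> \<in> A \<Longrightarrow> \<tau> k \<omega> = ennreal (real m * h)" and m: "m \<le> i" and r: "0 \<le> r"
    and f: "f \<in> bcontfun"
  shows "(\<integral>\<omega>\<in>A. f (X (real i * h + r) (\<omega> (Suc k))) \<partial>Q)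
       = (\<integral>\<omega>\<in>A. Pt r f (X (real i * h) (\<omega> (Suc k))) \<partial>Q)"
proof -
  interpret prob_space Q by (rule prob_space_Q)
  define t where "t = real i * h - real m * h"
  have t: "0 \<le> t" using m h by (simp add: t_def mult_right_mono)
  let ?S = "product_pre_sigma M F (Suc (Suc k)) (\<lambda>\<omega>. \<tau> k \<omega> + ennreal t)"
  interpret S: finite_measure_subalgebra Q ?S
    using subalgebra_pre_sigma by unfold_locales
  obtain B where B: "\<And>z. \<bar>f z\<bar> \<le> B" using bcontfun_bound[OF f] by metis
  have A\<Omega>: "A \<in> sets Q" using A sets_product_filtration sets_Q by blast
  let ?Z = "\<lambda>\<omega>. f (X (enn2real (\<tau> k \<omega>) + t + r) (\<omega> (Suc k)))"
  have Z: "integrable Q ?Z"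
  proof (rule integrable_bounded_Q[OF _ B])
    have "(\<lambda>\<omega>. f (X (max 0 (enn2real (\<tau> k \<omega>) + t + r)) (\<omega> (Suc k)))) \<in> borel_measurable \<Omega>"
      by (rule coordinate_path_measurable[OF f]) measurable
    then show "?Z \<in> borel_measurable \<Omega>" using t r by (simp add: max_def)
  qed
  have W: "(\<lambda>\<omega>. Pt r f (X (real i * h) (\<omega> (Suc k)))) \<in> borel_measurable Q"
    using coordinate_path_measurable[OF op_bcontfun'[OF r f], of "\<lambda>_. real i * h" "Suc k"] h
    by (simp add: measurable_Q)
  have tk: "enn2real (\<tau> k \<omega>) + t = real i * h" "\<tau> k \<omega> < \<infinity>" "\<tau> k \<omega> + ennreal t = ennreal (real i * h)"
    if "\<omega> \<in> A" for \<omega>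
    using last[OF that] h t by (auto simp: t_def ennreal_plus[symmetric] simp del: ennreal_plus)
  have AS: "A \<in> sets ?S"
  proof (rule in_pre_sigma)
    fix u
    have "{\<omega> \<in> A. \<tau> k \<omega> + ennreal t \<le> u} = (if ennreal (real i * h) \<le> u then A else {})"
      using tk(3) by auto
    then show "{\<omega> \<in> A. \<tau> k \<omega> + ennreal t \<le> u} \<in> sets (product_filtration M F (Suc (Suc k)) u)"
      using A sets_product_filtration_mono[of "Suc (Suc k)" "Suc (Suc k)" "ennreal (real i * h)" u] by auto
  qed
  have "\<forall>k. \<forall>t\<ge>0. \<forall>s\<ge>0. \<forall>f\<in>bcontfun. AE \<omega> in Q. \<tau> k \<omega> < \<infinity> \<longrightarrow>
        real_cond_exp Q (product_pre_sigma M F (Suc (Suc k)) (\<lambda>\<omega>. \<tau> k \<omega> + ennreal t))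
            (\<lambda>\<omega>. f (X (enn2real (\<tau> k \<omega>) + t + s) (\<omega> (Suc k)))) \<omega>
          = Pt s f (X (enn2real (\<tau> k \<omega>) + t) (\<omega> (Suc k)))"
    using law unfolding controlled_law_def by (elim conjE)
  from this[rule_format, OF t r f]
  have ae: "AE \<omega> in Q. \<tau> k \<omega> < \<infinity> \<longrightarrow>
        real_cond_exp Q ?S ?Z \<omega> = Pt r f (X (enn2real (\<tau> k \<omega>) + t) (\<omega> (Suc k)))" .
  have "(\<integral>\<omega>\<in>A. f (X (real i * h + r) (\<omega> (Suc k))) \<partial>Q) = (\<integral>\<omega>\<in>A. ?Z \<omega> \<partial>Q)"
    using A\<Omega> tk(1) by (intro set_lebesgue_integral_cong) auto
  also have "\<dots> = (\<integral>\<omega>\<in>A. real_cond_exp Q ?S ?Z \<omega> \<partial>Q)"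
    by (rule S.real_cond_exp_intA[OF Z AS])
  also have "\<dots> = (\<integral>\<omega>\<in>A. Pt r f (X (real i * h) (\<omega> (Suc k))) \<partial>Q)"
  proof (rule set_lebesgue_integral_cong_AE[OF A\<Omega> _ W])
    show "real_cond_exp Q ?S ?Z \<in> borel_measurable Q" by (rule borel_measurable_cond_exp2)
    from ae show "AE \<omega>\<in>A in Q. real_cond_exp Q ?S ?Z \<omega> = Pt r f (X (real i * h) (\<omega> (Suc k)))"
    proof (rule eventually_mono)
      fix \<omega> assume *: "\<tau> k \<omega> < \<infinity> \<longrightarrow> real_cond_exp Q ?S ?Z \<omega> = Pt r f (X (enn2real (\<tau> k \<omega>) + t) (\<omega> (Suc k)))"
      show "\<omega> \<in> A \<longrightarrow> real_cond_exp Q ?S ?Z \<omega> = Pt r f (X (real i * h) (\<omega> (Suc k)))"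
        using * tk(1,2)[of \<omega>] by simp
    qed
  qed
  finally show ?thesis .
qed

text \<open>
  Events of the first coordinate alone are preimages of events of the uncontrolled process, and under
  \<open>Q\<close> that coordinate has the law of the uncontrolled process.
\<close>

lemma markov_first_coordinate:
  assumes A: "A \<in> sets (product_filtration M F (Suc 0) (ennreal t))" and t: "0 \<le> t" "0 \<le> r"
    and f: "f \<in> bcontfun"
  shows "(\<integral>\<omega>\<in>A. f (X (t + r) (\<omega> 0)) \<partial>Q) = (\<integral>\<omega>\<in>A. Pt r f (X t (\<omega> 0)) \<partial>Q)"
proof -
  let ?N = "vimage_algebra (space \<Omega>) (\<lambda>\<omega>. \<omega> 0) (F (ennreal t))"
  have maps: "(\<lambda>\<omega>. \<omega> 0) \<in> space \<Omega> \<rightarrow> space (F (ennreal t))"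
    by (auto simp: space_F path_product_def space_PiM)
  have "sets (product_filtration M F (Suc 0) (ennreal t)) \<subseteq> sets ?N"
  proof (rule sets_product_filtration_subset)
    fix i B assume "i < Suc 0" "B \<in> sets (F (ennreal t))"
    then show "{\<omega> \<in> space \<Omega>. \<omega> i \<in> B} \<in> sets ?N"
      by (auto simp: sets_vimage_algebra2[OF maps] intro!: exI[of _ B])
  qed simp
  with A obtain B where B: "B \<in> sets (F (ennreal t))" and AB: "A = (\<lambda>\<omega>. \<omega> 0) -` B \<inter> space \<Omega>"
    by (auto simp: sets_vimage_algebra2[OF maps])
  have BM: "B \<in> sets M" using B sets_F by auto
  have d: "distr Q M (\<lambda>\<omega>. \<omega> 0) = P x" using law by (simp add: controlled_law_def)
  have c: "(\<integral>\<omega>\<in>A. k (\<omega> 0) \<partial>Q) = (\<integral>w\<in>B. k w \<partial>P x)" if k: "k \<in> borel_measurable M" for k :: "'w \<Rightarrow> real"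
  proof -
    have "(\<integral>w\<in>B. k w \<partial>P x) = (\<integral>\<omega>. indicator B (\<omega> 0) *\<^sub>R k (\<omega> 0) \<partial>Q)"
      unfolding d[symmetric] set_lebesgue_integral_def using k BM
      by (intro integral_distr) (auto simp: measurable_Q)
    also have "\<dots> = (\<integral>\<omega>\<in>A. k (\<omega> 0) \<partial>Q)"
      unfolding set_lebesgue_integral_def
      by (intro Bochner_Integration.integral_cong) (auto simp: AB space_Q split: split_indicator)
    finally show ?thesis by simp
  qed
  show ?thesis
    using c[OF measurable_comp_X[of "t + r" f]] c[OF measurable_comp_X[of t "Pt r f"]]
      markov_on_set[OF B t f, of x] t f op_bcontfun'[of r f] by simp
qed

text \<open>
  The event that at time \<open>i h\<close> coordinate \<open>k\<close> is active and was started by an impulse at time \<open>m h\<close>;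
  the initial coordinate, which no impulse has started, is given the label \<open>m = 0\<close>. These events are
  known at time \<open>i h\<close>, they are disjoint, and they cover the paths with finitely many impulses up
  to \<open>i h\<close>.
\<close>

definition regime :: "nat \<Rightarrow> nat \<Rightarrow> nat \<Rightarrow> (nat \<Rightarrow> 'w) set" where
  "regime i k m = {\<omega> \<in> space \<Omega>. (\<forall>j<k. \<tau> j \<omega> \<le> ennreal (real i * h)) \<and> ennreal (real i * h) < \<tau> k \<omega> \<and>
     (case k of 0 \<Rightarrow> m = 0 | Suc j \<Rightarrow> \<tau> j \<omega> = ennreal (real m * h))}"

lemma regime_bound: "regime i (Suc j) m \<noteq> {} \<Longrightarrow> m \<le> i"
  using h by (auto simp: regime_def dest!: spec[of _ j])

lemma regime_sets: "regime i k m \<in> sets (product_filtration M F (Suc k) (ennreal (real i * h)))"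
proof -
  let ?N = "product_filtration M F (Suc k) (ennreal (real i * h))"
  have sp: "space ?N = space \<Omega>" by (rule space_product_filtration)
  have 1: "{\<omega> \<in> space \<Omega>. \<tau> j \<omega> \<le> ennreal (real i * h)} \<in> sets ?N" if "j \<le> k" for j
  proof (rule subsetD[OF sets_product_filtration_mono])
    show "{\<omega> \<in> space \<Omega>. \<tau> j \<omega> \<le> ennreal (real i * h)} \<in> sets (product_filtration M F (Suc j) (ennreal (real i * h)))"
      using stopping_timeD[OF stopping_imp[of j], of "ennreal (real i * h)"]
      by (simp add: pred_def space_product_filtration)
  qed (use that in simp_all)
  have 2: "{\<omega> \<in> space \<Omega>. \<tau> j \<omega> = ennreal (real m * h)} \<in> sets ?N" if km: "k = Suc j" "m \<le> i" for j
  proof (rule subsetD[OF sets_product_filtration_mono])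
    show "{\<omega> \<in> space \<Omega>. \<tau> j \<omega> = ennreal (real m * h)} \<in> sets (product_filtration M F (Suc j) (ennreal (real m * h)))"
      using filtration.stopping_time_eq_const[OF filtration_product stopping_imp[of j], of "ennreal (real m * h)"]
      by (simp add: pred_def space_product_filtration)
    show "ennreal (real m * h) \<le> ennreal (real i * h)"
      using km h by (intro ennreal_leI mult_right_mono) simp_all
  qed (use km in simp)
  have 3: "{\<omega> \<in> space \<Omega>. \<forall>j<k. \<tau> j \<omega> \<le> ennreal (real i * h)} \<in> sets ?N"
  proof -
    have "{\<omega> \<in> space ?N. \<forall>j\<in>{..<k}. \<tau> j \<omega> \<le> ennreal (real i * h)} \<in> sets ?N"
    proof (rule sets.sets_Collect_finite_All)
      fix j assume "j \<in> {..<k}"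
      then show "{\<omega> \<in> space ?N. \<tau> j \<omega> \<le> ennreal (real i * h)} \<in> sets ?N"
        using 1[of j] by (simp add: sp)
    qed simp
    then show ?thesis unfolding sp Ball_def lessThan_iff .
  qed
  have 4: "{\<omega> \<in> space \<Omega>. ennreal (real i * h) < \<tau> k \<omega>} \<in> sets ?N"
    using stopping_timeD2[OF stopping_imp[of k], of "ennreal (real i * h)"] by (simp add: pred_def sp)
  show ?thesis
  proof (cases k)
    case 0
    have "regime i k m = (if m = 0 then {\<omega> \<in> space \<Omega>. ennreal (real i * h) < \<tau> k \<omega>} else {})"
      by (auto simp: regime_def 0)
    with 4 show ?thesis by simp
  next
    case (Suc j)
    show ?thesis
    proof (cases "m \<le> i")
      case True
      have "regime i k m = {\<omega> \<in> space \<Omega>. \<forall>j<k. \<tau> j \<omega> \<le> ennreal (real i * h)}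
          \<inter> {\<omega> \<in> space \<Omega>. ennreal (real i * h) < \<tau> k \<omega>} \<inter> {\<omega> \<in> space \<Omega>. \<tau> j \<omega> = ennreal (real m * h)}"
        by (auto simp: regime_def Suc)
      with 2[OF Suc True] 3 4 show ?thesis by (simp only: sets.Int)
    next
      case False
      then have "regime i k m = {}" using regime_bound[of i j m] Suc by blast
      then show ?thesis by simp
    qed
  qed
qed

lemma regime_sets_Q: "regime i k m \<in> sets Q"
  using regime_sets sets_product_filtration sets_Q by blast

lemma grid_gap:
  assumes "\<omega> \<in> space \<Omega>" "ennreal (real i * h) < \<tau> k \<omega>" shows "ennreal ((real i + 1) * h) \<le> \<tau> k \<omega>"
proof (cases "\<tau> k \<omega> = \<infinity>")
  case False
  then obtain m :: nat where m: "\<tau> k \<omega> = ennreal (real m * h)" using imp_time_grid[OF assms(1)] by blast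
  then have "real i * h < real m * h" using assms(2) h by (simp add: ennreal_less_iff)
  then have "real i + 1 \<le> real m" using h by simp
  then show ?thesis using h unfolding m by (intro ennreal_leI mult_right_mono) auto
qed simp

lemma regime_active:
  assumes w: "\<omega> \<in> regime i k m" and r: "0 \<le> r" "r < h"
  shows "Y (real i * h + r) \<omega> = X (real i * h + r) (\<omega> k)"
proof -
  have "(LEAST k. ennreal (real i * h + r) < \<tau> k \<omega>) = k"
  proof (rule Least_equality)
    have "ennreal (real i * h + r) < ennreal ((real i + 1) * h)"
      using r h by (simp add: ennreal_less_iff algebra_simps)
    also have "\<dots> \<le> \<tau> k \<omega>" using w by (intro grid_gap) (auto simp: regime_def)
    finally show "ennreal (real i * h + r) < \<tau> k \<omega>" .
  next
    fix j assume j: "ennreal (real i * h + r) < \<tau> j \<omega>"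
    show "k \<le> j"
    proof (rule ccontr)
      assume "\<not> k \<le> j"
      then have "\<tau> j \<omega> \<le> ennreal (real i * h)" using w by (auto simp: regime_def)
      also have "\<dots> \<le> ennreal (real i * h + r)" using r by (intro ennreal_leI) simp
      finally show False using j by simp
    qed
  qed
  then show ?thesis by (simp add: controlled_process_def)
qed

lemma regime_exists:
  assumes w: "\<omega> \<in> space \<Omega>" and ex: "\<exists>k. ennreal (real i * h) < \<tau> k \<omega>"
  shows "\<exists>k m. \<omega> \<in> regime i k m"
proof -
  define k where "k = (LEAST k. ennreal (real i * h) < \<tau> k \<omega>)"
  have k: "ennreal (real i * h) < \<tau> k \<omega>" unfolding k_def using ex by (rule LeastI_ex)
  have le: "\<tau> j \<omega> \<le> ennreal (real i * h)" if "j < k" for j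
    using not_less_Least[OF that[unfolded k_def]] by (simp add: not_less)
  show ?thesis
  proof (cases k)
    case 0
    with w k have "\<omega> \<in> regime i k 0" by (simp add: regime_def)
    then show ?thesis by blast
  next
    case (Suc j)
    with le[of j] have "\<tau> j \<omega> \<noteq> \<infinity>" using top_unique[of "ennreal (real i * h)"] by auto
    then obtain m :: nat where "\<tau> j \<omega> = ennreal (real m * h)" using imp_time_grid[OF w] by blast
    with w k le Suc have "\<omega> \<in> regime i k m" by (simp add: regime_def)
    then show ?thesis by blast
  qed
qed

lemma regime_unique:
  assumes 1: "\<omega> \<in> regime i k m" and 2: "\<omega> \<in> regime i k' m'" shows "k = k' \<and> m = m'"
proof -
  have "k = k'"
  proof (rule ccontr)
    assume "k \<noteq> k'"
    then consider "k < k'" | "k' < k" by linarith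
    then show False using 1 2 by cases (auto simp: regime_def)
  qed
  moreover have "m = m'"
    using 1 2 h unfolding \<open>k = k'\<close> by (auto simp: regime_def split: nat.splits)
  ultimately show ?thesis ..
qed

lemma controlled_jointly_measurable:
  assumes f: "(f :: 'e \<Rightarrow> real) \<in> bcontfun"
  shows "(\<lambda>(s, \<omega>). f (Y (max 0 s) \<omega>)) \<in> borel_measurable (borel \<Otimes>\<^sub>M \<Omega>)"
proof -
  have "(\<lambda>p. f (X (max 0 (fst p)) (snd p (LEAST k. ennreal (max 0 (fst p)) < \<tau> k (snd p)))))
      \<in> borel_measurable (borel \<Otimes>\<^sub>M \<Omega>)"
  proof (rule measurable_compose_countable[where f="\<lambda>k p. f (X (max 0 (fst p)) (snd p k))"
        and g="\<lambda>p. LEAST k. ennreal (max 0 (fst p)) < \<tau> k (snd p)"])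
    fix k
    have "(\<lambda>p. (fst p, snd p k)) \<in> borel \<Otimes>\<^sub>M \<Omega> \<rightarrow>\<^sub>M borel \<Otimes>\<^sub>M M"
      by (intro measurable_Pair measurable_fst measurable_compose[OF measurable_snd coordinate_measurable])
    from measurable_compose[OF this path_jointly_measurable[OF f]]
    show "(\<lambda>p. f (X (max 0 (fst p)) (snd p k))) \<in> borel_measurable (borel \<Otimes>\<^sub>M \<Omega>)" by simp
  next
    have [measurable]: "(\<lambda>p. \<tau> k (snd p)) \<in> borel_measurable (borel \<Otimes>\<^sub>M \<Omega>)" for k
      by (rule measurable_compose[OF measurable_snd imp_time_measurable])
    show "(\<lambda>p. LEAST k. ennreal (max 0 (fst p)) < \<tau> k (snd p)) \<in> borel \<Otimes>\<^sub>M \<Omega> \<rightarrow>\<^sub>M count_space UNIV"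
      by measurable
  qed
  then show ?thesis by (simp add: controlled_process_def split_beta')
qed

lemma controlled_measurable:
  assumes f: "(f :: 'e \<Rightarrow> real) \<in> bcontfun" and s: "0 \<le> s"
  shows "(\<lambda>\<omega>. f (Y s \<omega>)) \<in> borel_measurable \<Omega>"
proof -
  have "(\<lambda>\<omega>. (s, \<omega>)) \<in> \<Omega> \<rightarrow>\<^sub>M borel \<Otimes>\<^sub>M \<Omega>" by measurable
  from measurable_compose[OF this controlled_jointly_measurable[OF f]] s show ?thesis by simp
qed

lemma controlled_integrable:
  assumes f: "(f :: 'e \<Rightarrow> real) \<in> bcontfun" and s: "0 \<le> s"
  shows "integrable Q (\<lambda>\<omega>. f (Y s \<omega>))"
proof -
  obtain B where "\<And>z. \<bar>f z\<bar> \<le> B" using bcontfun_bound[OF f] by metis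
  then show ?thesis using controlled_measurable[OF f s] by (intro integrable_bounded_Q) auto
qed

text \<open>
  Within a regime both values of \<open>Y\<close> come from the same coordinate. Conditioning on time \<open>i h\<close> replaces
  \<open>f (Y (i h + r))\<close> by \<open>P\<^sub>r f (Y (i h))\<close>, which differs from \<open>f (Y (i h))\<close> by at most \<open>e\<close>.
\<close>

lemma regime_increment:
  assumes f: "f \<in> bcontfun" and r: "0 \<le> r" "r < h" and e: "\<And>z. \<bar>Pt r f z - f z\<bar> \<le> e"
  shows "\<bar>\<integral>\<omega>\<in>regime i k m. f (Y (real i * h + r) \<omega>) - f (Y (real i * h) \<omega>) \<partial>Q\<bar> \<le> e * measure Q (regime i k m)"
proof -
  interpret prob_space Q by (rule prob_space_Q)
  let ?R = "regime i k m" and ?t = "real i * h"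
  have t: "0 \<le> ?t" using h by simp
  obtain B where B: "\<And>z. \<bar>f z\<bar> \<le> B" using bcontfun_bound[OF f] by metis
  have m1: "(\<lambda>\<omega>. k' (X s (\<omega> k))) \<in> borel_measurable \<Omega>" if "k' \<in> bcontfun" "0 \<le> s" for k' :: "'e \<Rightarrow> real" and s
    using coordinate_path_measurable[OF that(1), of "\<lambda>_. s" k] that(2) by simp
  have int: "set_integrable Q ?R (\<lambda>\<omega>. k' (X s (\<omega> k)))" if k': "k' \<in> bcontfun" "0 \<le> s" for k' :: "'e \<Rightarrow> real" and s
  proof -
    obtain C where "\<And>z. \<bar>k' z\<bar> \<le> C" using bcontfun_bound[OF k'(1)] by metis
    then have "integrable Q (\<lambda>\<omega>. k' (X s (\<omega> k)))" using m1[OF k'] by (intro integrable_bounded_Q) auto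
    then show ?thesis unfolding set_integrable_def using integrable_mult_indicator[OF regime_sets_Q] by blast
  qed
  have markov: "(\<integral>\<omega>\<in>?R. f (X (?t + r) (\<omega> k)) \<partial>Q) = (\<integral>\<omega>\<in>?R. Pt r f (X ?t (\<omega> k)) \<partial>Q)"
  proof (cases k)
    case 0
    show ?thesis unfolding 0 by (rule markov_first_coordinate[OF regime_sets t r(1) f])
  next
    case (Suc j)
    show ?thesis
    proof (cases "m \<le> i")
      case True
      have last: "\<tau> j \<omega> = ennreal (real m * h)" if "\<omega> \<in> regime i (Suc j) m" for \<omega>
        using that by (simp add: regime_def)
      show ?thesis unfolding Suc by (rule markov_next_coordinate[OF regime_sets last True r(1) f])
    next
      case False
      then have "regime i (Suc j) m = {}" using regime_bound[of i j m] by blast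
      then show ?thesis unfolding Suc by (simp add: set_lebesgue_integral_def)
    qed
  qed
  have "(\<integral>\<omega>\<in>?R. f (Y (?t + r) \<omega>) - f (Y ?t \<omega>) \<partial>Q)
      = (\<integral>\<omega>\<in>?R. f (X (?t + r) (\<omega> k)) - f (X ?t (\<omega> k)) \<partial>Q)"
    using regime_active[of _ i k m r] regime_active[of _ i k m 0] r h regime_sets_Q
    by (intro set_lebesgue_integral_cong) auto
  also have "\<dots> = (\<integral>\<omega>\<in>?R. Pt r f (X ?t (\<omega> k)) - f (X ?t (\<omega> k)) \<partial>Q)"
    unfolding set_integral_diff(2)[OF int[OF f, of "?t + r", OF add_nonneg_nonneg[OF t r(1)]] int[OF f t]]
      set_integral_diff(2)[OF int[OF op_bcontfun'[OF r(1) f] t] int[OF f t]] markov ..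
  also have "\<bar>\<dots>\<bar> \<le> (\<integral>\<omega>. e * indicator ?R \<omega> \<partial>Q)"
    unfolding set_lebesgue_integral_def
  proof (rule order_trans[OF integral_abs_bound integral_mono])
    show "integrable Q (\<lambda>\<omega>. \<bar>indicator ?R \<omega> *\<^sub>R (Pt r f (X ?t (\<omega> k)) - f (X ?t (\<omega> k)))\<bar>)"
      using set_integral_diff(1)[OF int[OF op_bcontfun'[OF r(1) f] t] int[OF f t]]
      unfolding set_integrable_def by (rule integrable_abs)
    show "integrable Q (\<lambda>\<omega>. e * indicator ?R \<omega>)"
      using regime_sets_Q[of i k m] by (intro integrable_mult_right) (simp add: emeasure_eq_measure)
    show "\<bar>indicator ?R \<omega> *\<^sub>R (Pt r f (X ?t (\<omega> k)) - f (X ?t (\<omega> k)))\<bar> \<le> e * indicator ?R \<omega>" for \<omega>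
      using e[of "X ?t (\<omega> k)"] by (simp split: split_indicator)
  qed
  also have "(\<integral>\<omega>. e * indicator ?R \<omega> \<partial>Q) = e * measure Q ?R"
    using regime_sets_Q[of i k m] by simp
  finally show ?thesis .
qed

text \<open>
  The bounds for the countably many regimes are proportional to their probabilities, which add up
  to \<open>1\<close>.
\<close>

lemma expected_increment:
  assumes f: "f \<in> bcontfun" and r: "0 \<le> r" "r < h" and e: "\<And>z. \<bar>Pt r f z - f z\<bar> \<le> e"
    and fin: "AE \<omega> in Q. \<exists>k. ennreal (real i * h) < \<tau> k \<omega>"
  shows "\<bar>(\<integral>\<omega>. f (Y (real i * h + r) \<omega>) \<partial>Q) - (\<integral>\<omega>. f (Y (real i * h) \<omega>) \<partial>Q)\<bar> \<le> e"
proof -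
  interpret prob_space Q by (rule prob_space_Q)
  define R where "R n = (case prod_decode n of (k, m) \<Rightarrow> regime i k m)" for n
  let ?d = "\<lambda>\<omega>. f (Y (real i * h + r) \<omega>) - f (Y (real i * h) \<omega>)"
  have t: "0 \<le> real i * h" using h by simp
  have int: "integrable Q ?d"
    using r t by (intro Bochner_Integration.integrable_diff controlled_integrable f) auto
  have RQ: "R n \<in> sets Q" for n by (simp add: R_def regime_sets_Q split: prod.split)
  then have UQ: "(\<Union>n. R n) \<in> sets Q" by blast
  have disj: "R n \<inter> R n' = {}" if "n \<noteq> n'" for n n'
  proof (rule ccontr)
    assume "R n \<inter> R n' \<noteq> {}"
    then obtain \<omega> where "\<omega> \<in> R n" "\<omega> \<in> R n'" by blast
    moreover obtain k m k' m' where "prod_decode n = (k, m)" "prod_decode n' = (k', m')"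
      by (meson surj_pair)
    ultimately have "prod_decode n = prod_decode n'"
      using regime_unique[of \<omega> i k m k' m'] by (simp add: R_def)
    with that show False by (simp add: inj_eq[OF inj_prod_decode])
  qed
  have cover: "AE \<omega> in Q. \<omega> \<in> (\<Union>n. R n)"
    using fin AE_space
  proof eventually_elim
    fix \<omega> assume "\<exists>k. ennreal (real i * h) < \<tau> k \<omega>" "\<omega> \<in> space Q"
    with regime_exists[of \<omega> i] obtain k m where "\<omega> \<in> regime i k m" by (auto simp: space_Q)
    then have "\<omega> \<in> R (prod_encode (k, m))" by (simp add: R_def)
    then show "\<omega> \<in> (\<Union>n. R n)" by blast
  qed
  have setint: "set_integrable Q (\<Union>n. R n) ?d"
    unfolding set_integrable_def using integrable_mult_indicator[OF UQ int] by simp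
  have "(\<integral>\<omega>. ?d \<omega> \<partial>Q) = (\<integral>\<omega>\<in>(\<Union>n. R n). ?d \<omega> \<partial>Q)"
    unfolding set_lebesgue_integral_def
  proof (rule integral_cong_AE)
    show "AE \<omega> in Q. ?d \<omega> = indicat_real (\<Union>n. R n) \<omega> *\<^sub>R ?d \<omega>"
      using cover by (rule eventually_mono) simp
    show "(\<lambda>\<omega>. indicat_real (\<Union>n. R n) \<omega> *\<^sub>R ?d \<omega>) \<in> borel_measurable Q"
      using setint unfolding set_integrable_def by (rule borel_measurable_integrable)
  qed (rule borel_measurable_integrable[OF int])
  also have "\<dots> = (\<Sum>n. \<integral>\<omega>\<in>R n. ?d \<omega> \<partial>Q)"
    using RQ disj setint by (rule lebesgue_integral_countable_add)
  finally have eq: "(\<integral>\<omega>. ?d \<omega> \<partial>Q) = (\<Sum>n. \<integral>\<omega>\<in>R n. ?d \<omega> \<partial>Q)" .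
  have bound: "\<bar>\<integral>\<omega>\<in>R n. ?d \<omega> \<partial>Q\<bar> \<le> e * measure Q (R n)" for n
    unfolding R_def using regime_increment[OF f r e] by (simp split: prod.split)
  have sums: "(\<lambda>n. measure Q (R n)) sums measure Q (\<Union>n. R n)"
    using RQ disj by (intro finite_measure_UNION) (auto simp: disjoint_family_on_def)
  have "measure Q (\<Union>n. R n) = 1"
    using prob_eq_1[OF UQ] cover by simp
  with sums_mult[OF sums, of e] have se: "(\<lambda>n. e * measure Q (R n)) sums e" by simp
  have s1: "summable (\<lambda>n. \<bar>\<integral>\<omega>\<in>R n. ?d \<omega> \<partial>Q\<bar>)"
    by (rule summable_comparison_test'[OF sums_summable[OF se], of 0]) (use bound in simp)
  have "\<bar>\<Sum>n. \<integral>\<omega>\<in>R n. ?d \<omega> \<partial>Q\<bar> \<le> (\<Sum>n. \<bar>\<integral>\<omega>\<in>R n. ?d \<omega> \<partial>Q\<bar>)"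
    by (rule summable_rabs[OF s1])
  also have "\<dots> \<le> (\<Sum>n. e * measure Q (R n))"
    by (rule suminf_le[OF bound s1 sums_summable[OF se]])
  also have "\<dots> = e" using se by (rule sums_unique[symmetric])
  finally have "\<bar>\<integral>\<omega>. ?d \<omega> \<partial>Q\<bar> \<le> e" by (simp only: eq)
  moreover have "(\<integral>\<omega>. ?d \<omega> \<partial>Q) = (\<integral>\<omega>. f (Y (real i * h + r) \<omega>) \<partial>Q) - (\<integral>\<omega>. f (Y (real i * h) \<omega>) \<partial>Q)"
    using r(1) t by (intro Bochner_Integration.integral_diff controlled_integrable[OF f]) linarith+
  ultimately show ?thesis by (simp only:)
qed

end

section \<open>Expected costs and their averages\<close>

text \<open>
  Both sides are compared through \<open>Z\<^sup>+ + a\<^sup>- = Z\<^sup>- + a\<^sup>+ + b\<close> for \<open>Z = a + b\<close>, an identity of nonnegative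
  functions that also holds where \<open>b\<close> is infinite. Boundedness of \<open>a\<close> keeps all terms but the positive
  part of \<open>Z\<close> and \<open>b\<close> integrable.
\<close>

lemma ereal_expectation_split:
  assumes Q: "prob_space Q" and a[measurable]: "a \<in> borel_measurable Q" and K: "\<And>\<omega>. \<bar>a \<omega>\<bar> \<le> K"
    and b[measurable]: "b \<in> borel_measurable Q"
  shows "ereal_expectation Q (\<lambda>\<omega>. ereal (a \<omega>) + enn2ereal (b \<omega>)) = ereal (\<integral>\<omega>. a \<omega> \<partial>Q) + enn2ereal (\<integral>\<^sup>+\<omega>. b \<omega> \<partial>Q)"
proof -
  interpret prob_space Q by fact
  let ?Z = "\<lambda>\<omega>. ereal (a \<omega>) + enn2ereal (b \<omega>)"
  have int: "integrable Q a" using K by (intro integrable_const_bound[of _ K]) auto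
  have pm[measurable]: "(\<lambda>\<omega>. e2ennreal (?Z \<omega>)) \<in> borel_measurable Q" "(\<lambda>\<omega>. e2ennreal (- ?Z \<omega>)) \<in> borel_measurable Q"
    by measurable
  have pt: "e2ennreal (?Z \<omega>) + ennreal (- a \<omega>) = e2ennreal (- ?Z \<omega>) + (ennreal (a \<omega>) + b \<omega>)" for \<omega>
  proof (cases "b \<omega>")
    case (real \<beta>)
    then have 1: "e2ennreal (?Z \<omega>) = ennreal (a \<omega> + \<beta>)" "e2ennreal (- ?Z \<omega>) = ennreal (- (a \<omega> + \<beta>))" by simp_all
    have nn: "ennreal t = ennreal (max 0 t)" for t by (simp add: ennreal_neg max_def)
    have 2: "ennreal (max 0 (a \<omega> + \<beta>)) + ennreal (max 0 (- a \<omega>)) = ennreal (max 0 (a \<omega> + \<beta>) + max 0 (- a \<omega>))"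
      by (rule ennreal_plus[symmetric]) auto
    have 3: "ennreal (max 0 (- (a \<omega> + \<beta>))) + (ennreal (max 0 (a \<omega>)) + ennreal \<beta>)
        = ennreal (max 0 (- (a \<omega> + \<beta>)) + (max 0 (a \<omega>) + \<beta>))"
      using real(1) ennreal_plus[of "max 0 (a \<omega>)" \<beta>] ennreal_plus[of "max 0 (- (a \<omega> + \<beta>))" "max 0 (a \<omega>) + \<beta>"] by simp
    have "max 0 (a \<omega> + \<beta>) + max 0 (- a \<omega>) = max 0 (- (a \<omega> + \<beta>)) + (max 0 (a \<omega>) + \<beta>)" by linarith
    then show ?thesis unfolding 1 unfolding real(2) nn[of "a \<omega> + \<beta>"] nn[of "- (a \<omega> + \<beta>)"] nn[of "- a \<omega>"] nn[of "a \<omega>"] 2 3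
      by (rule arg_cong)
  next
    case top
    then show ?thesis by simp
  qed
  define p n m q t where "p = (\<integral>\<^sup>+\<omega>. e2ennreal (?Z \<omega>) \<partial>Q)" and "n = (\<integral>\<^sup>+\<omega>. e2ennreal (- ?Z \<omega>) \<partial>Q)"
    and "m = (\<integral>\<^sup>+\<omega>. ennreal (- a \<omega>) \<partial>Q)" and "q = (\<integral>\<^sup>+\<omega>. ennreal (a \<omega>) \<partial>Q)" and "t = (\<integral>\<^sup>+\<omega>. b \<omega> \<partial>Q)"
  have eq: "p + m = n + (q + t)"
  proof -
    have "p + m = (\<integral>\<^sup>+\<omega>. e2ennreal (?Z \<omega>) + ennreal (- a \<omega>) \<partial>Q)"
      unfolding p_def m_def by (rule nn_integral_add[symmetric]) measurable
    also have "\<dots> = (\<integral>\<^sup>+\<omega>. e2ennreal (- ?Z \<omega>) + (ennreal (a \<omega>) + b \<omega>) \<partial>Q)"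
      by (simp only: pt)
    also have "\<dots> = n + (q + t)"
      unfolding n_def q_def t_def by (subst nn_integral_add; (subst nn_integral_add)?; measurable)
    finally show ?thesis .
  qed
  have le: "n \<le> m"
    unfolding n_def m_def
  proof (rule nn_integral_mono)
    fix \<omega>
    have "ereal (a \<omega>) + 0 \<le> ?Z \<omega>" by (intro add_left_mono) simp
    then have "- ?Z \<omega> \<le> ereal (- a \<omega>)" by (simp add: ereal_uminus_le_reorder)
    from e2ennreal_mono[OF this] show "e2ennreal (- ?Z \<omega>) \<le> ennreal (- a \<omega>)" by simp
  qed
  have fin: "m < top" "q < top"
    using int unfolding real_integrable_def m_def q_def by (auto simp: less_top)
  have ia: "(\<integral>\<omega>. a \<omega> \<partial>Q) = enn2real q - enn2real m"
    unfolding q_def m_def using int by (rule real_lebesgue_integral_def)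
  obtain m' where m': "0 \<le> m'" "m = ennreal m'" using fin(1) by (cases m) auto
  obtain q' where q': "0 \<le> q'" "q = ennreal q'" using fin(2) by (cases q) auto
  obtain n' where n': "0 \<le> n'" "n = ennreal n'" using fin(1) le by (cases n) (auto simp: top_unique)
  have "enn2ereal p - enn2ereal n = ereal (enn2real q - enn2real m) + enn2ereal t"
  proof (cases t)
    case (real t')
    then have pm': "p + ennreal m' = ennreal (n' + (q' + t'))" using eq m' q' n' by simp
    then obtain p' where p': "0 \<le> p'" "p = ennreal p'" by (cases p) auto
    with pm' m' q' n' real have "p' + m' = n' + (q' + t')" by (simp add: ennreal_plus[symmetric] del: ennreal_plus)
    then show ?thesis using p' m' q' n' real by simp
  next
    case top
    then have "p + m = top" using eq by simp
    then have "p = top" using m' by simp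
    then show ?thesis using top n' by simp
  qed
  then show ?thesis unfolding ereal_expectation_def ia p_def n_def t_def .
qed

lemma set_integral_abs_bound:
  fixes k :: "real \<Rightarrow> real"
  assumes k: "k \<in> borel_measurable borel" and A: "A \<in> sets borel" "emeasure lborel A < \<infinity>" and K: "\<And>s. s \<in> A \<Longrightarrow> \<bar>k s\<bar> \<le> K"
  shows "set_integrable lborel A k" and "\<bar>LINT s:A|lborel. k s\<bar> \<le> K * measure lborel A"
proof -
  have K': "integrable lborel (\<lambda>s. K * indicator A s)" using A by (intro integrable_mult_right) simp
  have le: "\<bar>indicator A s *\<^sub>R k s\<bar> \<le> K * indicator A s" for s using K[of s] by (simp split: split_indicator)
  show si: "set_integrable lborel A k"
    unfolding set_integrable_def
  proof (rule Bochner_Integration.integrable_bound[OF K'])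
    show "AE s in lborel. norm (indicator A s *\<^sub>R k s) \<le> norm (K * indicator A s)"
      using le by (intro AE_I2) (metis abs_ge_self order_trans real_norm_def)
  qed (use k A in measurable)
  have "\<bar>LINT s:A|lborel. k s\<bar> \<le> (\<integral>s. K * indicator A s \<partial>lborel)"
    unfolding set_lebesgue_integral_def
    using si K' le unfolding set_integrable_def
    by (intro order_trans[OF integral_abs_bound integral_mono] integrable_abs)
  also have "\<dots> = K * measure lborel A" using A by simp
  finally show "\<bar>LINT s:A|lborel. k s\<bar> \<le> K * measure lborel A" .
qed

text \<open>
  Each of the \<open>n\<close> cells contributes at most \<open>h e\<close>. The incomplete last cell contributes at most
  \<open>G h\<close>, and passing from left endpoints to the indices \<open>1, \<dots>, n\<close> exchanges \<open>u 0\<close> for \<open>u (n h)\<close>, which costs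
  at most \<open>2 G h\<close>.
\<close>

lemma integral_grid_sum_difference:
  fixes u :: "real \<Rightarrow> real"
  assumes u: "u \<in> borel_measurable borel" and G: "\<And>s. 0 \<le> s \<Longrightarrow> \<bar>u s\<bar> \<le> G" and h: "0 < h"
    and e: "\<And>i r. i < n \<Longrightarrow> 0 \<le> r \<Longrightarrow> r < h \<Longrightarrow> \<bar>u (real i * h + r) - u (real i * h)\<bar> \<le> e"
    and T: "real n * h \<le> T" "T < (real n + 1) * h"
  shows "\<bar>(LINT s:{0..T}|lborel. u s) - h * (\<Sum>i=1..n. u (real i * h))\<bar> \<le> real n * h * e + 3 * G * h"
proof -
  have G0: "0 \<le> G" using G[of 0] by simp
  have int: "set_integrable lborel A u" if "A \<in> sets borel" "emeasure lborel A < \<infinity>" "\<And>s. s \<in> A \<Longrightarrow> 0 \<le> s" for A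
    using that G by (intro set_integral_abs_bound(1)[OF u, where K=G]) auto
  have step: "\<bar>(LINT s:{0..<real m * h}|lborel. u s) - h * (\<Sum>i<m. u (real i * h))\<bar> \<le> real m * h * e" if "m \<le> n" for m
    using that
  proof (induction m)
    case 0
    show ?case by (simp add: set_lebesgue_integral_def)
  next
    case (Suc m)
    let ?A = "{real m * h..<real (Suc m) * h}"
    have le: "0 \<le> real m * h" "real m * h \<le> real (Suc m) * h" using h by (auto simp: algebra_simps)
    have split: "{0..<real (Suc m) * h} = {0..<real m * h} \<union> ?A" using le by auto
    have i1: "(LINT s:{0..<real (Suc m) * h}|lborel. u s) = (LINT s:{0..<real m * h}|lborel. u s) + (LINT s:?A|lborel. u s)"
      unfolding split
    proof (rule set_integral_Un)
      show "set_integrable lborel {0..<real m * h} u" "set_integrable lborel ?A u"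
        using le by (intro int; simp)+
    qed auto
    have meas: "measure lborel ?A = h" using le by (simp add: algebra_simps)
    have "\<bar>LINT s:?A|lborel. u s - u (real m * h)\<bar> \<le> e * measure lborel ?A"
    proof (rule set_integral_abs_bound(2))
      fix s assume s: "s \<in> ?A"
      with Suc.prems show "\<bar>u s - u (real m * h)\<bar> \<le> e"
        using e[of m "s - real m * h"] by (simp add: algebra_simps)
    qed (use u le in auto)
    moreover have "(LINT s:?A|lborel. u s - u (real m * h)) = (LINT s:?A|lborel. u s) - h * u (real m * h)"
    proof -
      have "set_integrable lborel ?A (\<lambda>_. u (real m * h))"
        using le by (intro set_integral_abs_bound(1)[where K="\<bar>u (real m * h)\<bar>"]) auto
      moreover have "set_integrable lborel ?A u" using le by (intro int) auto
      moreover have "(LINT s:?A|lborel. u (real m * h)) = h * u (real m * h)"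
        using meas by (simp add: set_lebesgue_integral_def)
      ultimately show ?thesis by (simp only: set_integral_diff(2))
    qed
    ultimately have "\<bar>(LINT s:?A|lborel. u s) - h * u (real m * h)\<bar> \<le> e * h" by (simp only: meas)
    moreover have "\<bar>(LINT s:{0..<real m * h}|lborel. u s) - h * (\<Sum>i<m. u (real i * h))\<bar> \<le> real m * h * e"
      using Suc by simp
    moreover have "h * (\<Sum>i<Suc m. u (real i * h)) = h * (\<Sum>i<m. u (real i * h)) + h * u (real m * h)"
      by (simp add: algebra_simps)
    moreover have "real (Suc m) * h * e = real m * h * e + e * h" by (simp add: algebra_simps)
    ultimately show ?case using i1 by linarith
  qed
  have nh: "0 \<le> real n * h" using h by simp
  let ?B = "{real n * h..T}"
  have split: "{0..T} = {0..<real n * h} \<union> ?B" using nh T by auto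
  have i1: "(LINT s:{0..T}|lborel. u s) = (LINT s:{0..<real n * h}|lborel. u s) + (LINT s:?B|lborel. u s)"
    unfolding split
  proof (rule set_integral_Un)
    show "set_integrable lborel {0..<real n * h} u" "set_integrable lborel ?B u"
      using nh T by (intro int; simp)+
  qed auto
  have "\<bar>LINT s:?B|lborel. u s\<bar> \<le> G * measure lborel ?B"
    using G nh T by (intro set_integral_abs_bound(2) u) auto
  also have "\<dots> \<le> G * h" using T G0 by (intro mult_left_mono) (auto simp: algebra_simps)
  finally have B: "\<bar>LINT s:?B|lborel. u s\<bar> \<le> G * h" .
  have "(\<Sum>i=1..n. u (real i * h)) = (\<Sum>i<n. u (real i * h)) + (u (real n * h) - u 0)"
    by (induction n) (simp_all add: algebra_simps)
  then have sh: "h * (\<Sum>i=1..n. u (real i * h)) = h * (\<Sum>i<n. u (real i * h)) + h * (u (real n * h) - u 0)"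
    by (simp only: distrib_left)
  have "\<bar>u (real n * h) - u 0\<bar> \<le> 2 * G" using G[OF nh] G[of 0] by simp
  then have "\<bar>h * (u (real n * h) - u 0)\<bar> \<le> h * (2 * G)"
    using h by (simp only: abs_mult abs_of_pos mult_le_cancel_left_pos)
  moreover have "h * (2 * G) = 2 * (G * h)" "3 * G * h = 3 * (G * h)" by (simp_all add: algebra_simps)
  ultimately show ?thesis using step[of n] B i1 sh by linarith
qed

text \<open>
  Costs that differ by at most \<open>n h e + D\<close> have averages that differ by at most \<open>e\<close> in the limit. Passing
  from \<open>T\<close> to the grid point \<open>n h\<close> below it is harmless, since \<open>n h / T\<close> tends to \<open>1\<close>. The upper limits are
  compared through their real upper bounds \<open>L\<close>, which keeps infinite values out of the arithmetic.
\<close>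

lemma average_limits:
  fixes A :: "real \<Rightarrow> ereal" and B :: "nat \<Rightarrow> ereal"
  assumes h: "0 < h" and cmp: "\<And>n T. real n * h \<le> T \<Longrightarrow> T < (real n + 1) * h \<Longrightarrow>
      (A T = \<infinity> \<and> B n = \<infinity>) \<or> (\<exists>a b. A T = ereal a \<and> B n = ereal b \<and> \<bar>a - h * b\<bar> \<le> real n * h * e + D)"
  shows "limsup (\<lambda>n. ereal (1 / real n) * B n) \<le> Limsup at_top (\<lambda>T. A T / ereal T) + ereal e" (is "?L \<le> ?R + _")
    and "Limsup at_top (\<lambda>T. A T / ereal T) \<le> limsup (\<lambda>n. ereal (1 / real n) * B n) + ereal e"
proof -
  have gap: "\<exists>L z. w < ereal L \<and> ereal z < y \<and> L + e < z" if "w + ereal e < y" for w y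
  proof -
    have "w < y - ereal e" using that by (simp add: ereal_less_minus)
    then obtain L where L: "w < ereal L" "ereal L < y - ereal e" using ereal_dense2 by blast
    then have "ereal (L + e) < y" by (simp add: ereal_less_minus flip: plus_ereal.simps)
    then obtain z where "ereal (L + e) < ereal z" "ereal z < y" using ereal_dense2 by blast
    with L show ?thesis by auto
  qed
  show "?L \<le> ?R + ereal e"
    unfolding Limsup_le_iff
  proof (intro allI impI)
    fix y assume "?R + ereal e < y"
    from gap[OF this] obtain L z where L: "?R < ereal L" and z: "ereal z < y" "L + e < z" by blast
    have "\<forall>\<^sub>F T in at_top. A T / ereal T < ereal L" using L by (rule Limsup_lessD)
    then obtain T0 where T0: "\<And>T. T0 \<le> T \<Longrightarrow> A T / ereal T < ereal L" by (auto simp: eventually_at_top_linorder)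
    \<comment> \<open>beyond \<open>N\<close>, the grid point is past \<open>T0\<close>, and the gap between \<open>L + e\<close> and \<open>z\<close> absorbs the constant \<open>D\<close>\<close>
    define N where "N = nat \<lceil>max (max 1 (T0 / h)) (\<bar>D\<bar> / h / (z - (L + e)) + 1)\<rceil>"
    have "ereal (1 / real n) * B n < y" if n: "N \<le> n" for n
    proof -
      have N: "max (max 1 (T0 / h)) (\<bar>D\<bar> / h / (z - (L + e)) + 1) \<le> real n"
        using n unfolding N_def by linarith
      have "\<bar>D\<bar> / h / (z - (L + e)) < real n" using N by linarith
      moreover have "0 < z - (L + e)" using z(2) by simp
      ultimately have "\<bar>D\<bar> / h < real n * (z - (L + e))" by (simp only: pos_divide_less_eq)
      moreover have "T0 / h \<le> real n" using N by linarith
      ultimately have n1: "1 \<le> real n" "T0 \<le> real n * h" "\<bar>D\<bar> / h < real n * (z - (L + e))"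
        using N h by (simp_all add: pos_divide_le_eq)
      have lt: "A (real n * h) / ereal (real n * h) < ereal L" using T0[OF n1(2)] .
      from cmp[of n "real n * h"] h have "(A (real n * h) = \<infinity> \<and> B n = \<infinity>) \<or>
        (\<exists>a b. A (real n * h) = ereal a \<and> B n = ereal b \<and> \<bar>a - h * b\<bar> \<le> real n * h * e + D)" by simp
      then consider "A (real n * h) = \<infinity>" | a b where "A (real n * h) = ereal a" "B n = ereal b" "\<bar>a - h * b\<bar> \<le> real n * h * e + D"
        by blast
      then show ?thesis
      proof cases
        case 1
        with lt n1 h show ?thesis by simp
      next
        case 2
        have "a < L * (real n * h)" using lt 2(1) n1 h by (simp add: divide_less_eq)
        then have "h * b < real n * h * (L + e) + \<bar>D\<bar>" using 2(3) by (simp add: algebra_simps)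
        moreover have "\<bar>D\<bar> < real n * (z - (L + e)) * h" using n1(3) h by (simp only: pos_divide_less_eq)
        ultimately have "h * b < h * (real n * z)" by (simp add: algebra_simps)
        then have "b < real n * z" using h by simp
        then have "1 / real n * b < z" using n1 by (simp add: divide_less_eq mult.commute)
        then have "ereal (1 / real n) * B n < ereal z" by (simp add: 2)
        with z(1) show ?thesis by (rule order_less_trans[rotated])
      qed
    qed
    then show "\<forall>\<^sub>F n in sequentially. ereal (1 / real n) * B n < y" by (auto simp: eventually_sequentially)
  qed
  show "?R \<le> ?L + ereal e"
    unfolding Limsup_le_iff
  proof (intro allI impI)
    fix y assume "?L + ereal e < y"
    from gap[OF this] obtain L z where L: "?L < ereal L" and z: "ereal z < y" "L + e < z" by blast
    have "\<forall>\<^sub>F n in sequentially. ereal (1 / real n) * B n < ereal L" using L by (rule Limsup_lessD)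
    then obtain N where N: "\<And>n. N \<le> n \<Longrightarrow> ereal (1 / real n) * B n < ereal L" by (auto simp: eventually_sequentially)
    \<comment> \<open>beyond \<open>T0\<close>, the gap between \<open>L + e\<close> and \<open>z\<close> absorbs \<open>D\<close> and the error of replacing \<open>n h\<close> by \<open>T\<close>\<close>
    define T0 where "T0 = max ((real N + 1) * h) (max h ((\<bar>L + e\<bar> * h + \<bar>D\<bar>) / (z - (L + e)) + 1))"
    have "A T / ereal T < y" if T: "T0 \<le> T" for T
    proof -
      have T1: "(real N + 1) * h \<le> T" "h \<le> T" "(\<bar>L + e\<bar> * h + \<bar>D\<bar>) / (z - (L + e)) < T"
        using T unfolding T0_def by linarith+
      define n where "n = nat \<lfloor>T / h\<rfloor>"
      have Th: "1 \<le> T / h" "real N + 1 \<le> T / h" using T1 h by (simp_all add: le_divide_eq)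
      have rn1: "real n \<le> T / h" "T / h < real n + 1"
        using Th unfolding n_def by linarith+
      then have "real N < real n" "0 < real n" using Th by linarith+
      then have rn: "real n \<le> T / h" "T / h < real n + 1" "1 \<le> real n" "N \<le> n"
        using rn1 by simp_all
      have nT: "real n * h \<le> T" "T < (real n + 1) * h" using rn h by (simp_all add: le_divide_eq divide_less_eq)
      have Tpos: "0 < T" using T1(2) h by simp
      have lt: "ereal (1 / real n) * B n < ereal L" using N[OF rn(4)] .
      from cmp[OF nT] consider "B n = \<infinity>" | a b where "A T = ereal a" "B n = ereal b" "\<bar>a - h * b\<bar> \<le> real n * h * e + D"
        by blast
      then show ?thesis
      proof cases
        case 1
        with lt rn(3) show ?thesis by simp
      next
        case 2
        have "b < L * real n" using lt 2(2) rn(3) by (simp add: divide_less_eq)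
        then have "h * b < h * (L * real n)" using h by simp
        then have 1: "a < (L + e) * (real n * h) + \<bar>D\<bar>" using 2(3) by (simp add: algebra_simps)
        have "(L + e) * (real n * h - T) \<le> \<bar>L + e\<bar> * \<bar>real n * h - T\<bar>" by (metis abs_ge_self abs_mult)
        also have "\<dots> \<le> \<bar>L + e\<bar> * h" using nT by (intro mult_left_mono) (auto simp: algebra_simps)
        finally have "a < (L + e) * T + \<bar>L + e\<bar> * h + \<bar>D\<bar>" using 1 by (simp add: algebra_simps)
        moreover have "\<bar>L + e\<bar> * h + \<bar>D\<bar> < T * (z - (L + e))" using T1(3) z(2) by (simp add: divide_less_eq)
        ultimately have "a < z * T" by (simp add: algebra_simps)
        then have "A T / ereal T < ereal z" using Tpos by (simp add: 2 divide_less_eq)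
        with z(1) show ?thesis by (rule order_less_trans[rotated])
      qed
    qed
    then show "\<forall>\<^sub>F T in at_top. A T / ereal T < y" by (auto simp: eventually_at_top_linorder)
  qed
qed

context grid_controlled_process
begin

text \<open>
  The cost is evaluated at a random time. Right-continuity makes it jointly measurable in the time and
  the two paths, and the random time is then substituted.
\<close>

lemma impulse_cost_measurable:
  assumes c: "case_prod c \<in> bcontfun"
  shows "(impulse_cost X c V k) \<in> borel_measurable \<Omega>"
proof -
  have cc: "continuous_on UNIV (\<lambda>p. c (fst p) (snd p) :: real)" using c by (simp add: bcontfun_def split_beta')
  have cm: "(\<lambda>p. c (fst p) (snd p)) \<in> borel_measurable borel" by (rule borel_measurable_continuous_onI[OF cc])
  have J: "(\<lambda>(s, p). c (X (max 0 s) (fst p)) (X (max 0 s) (snd p))) \<in> borel_measurable (borel \<Otimes>\<^sub>M (M \<Otimes>\<^sub>M M))"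
  proof (rule right_continuous_jointly_measurable[of "\<lambda>s p. c (X s (fst p)) (X s (snd p))"])
    fix s :: real assume s: "0 < s"
    have "(\<lambda>p. (X s (fst p), X s (snd p))) \<in> borel_measurable (M \<Otimes>\<^sub>M M)"
      using X_measurable[of s] s
      by (intro borel_measurable_Pair measurable_compose[OF measurable_fst] measurable_compose[OF measurable_snd]) simp_all
    from measurable_compose[OF this cm]
    show "(\<lambda>p. c (X s (fst p)) (X s (snd p))) \<in> borel_measurable (M \<Otimes>\<^sub>M M)" by simp
  next
    fix s :: real and p assume s: "0 \<le> s" and p: "p \<in> space (M \<Otimes>\<^sub>M M)"
    have "((\<lambda>s. X s (fst p)) \<longlongrightarrow> X s (fst p)) (at_right s)" "((\<lambda>s. X s (snd p)) \<longlongrightarrow> X s (snd p)) (at_right s)"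
      using paths[of "fst p" s] paths[of "snd p" s] s p by (auto simp: continuous_within space_pair_measure)
    then have "((\<lambda>s. (X s (fst p), X s (snd p))) \<longlongrightarrow> (X s (fst p), X s (snd p))) (at_right s)"
      by (rule tendsto_Pair)
    moreover have "isCont (\<lambda>p. c (fst p) (snd p)) (X s (fst p), X s (snd p))"
      using cc by (simp add: continuous_on_eq_continuous_at)
    ultimately have "((\<lambda>s. c (fst (X s (fst p), X s (snd p))) (snd (X s (fst p), X s (snd p))))
        \<longlongrightarrow> c (fst (X s (fst p), X s (snd p))) (snd (X s (fst p), X s (snd p)))) (at_right s)"
      by (rule isCont_tendsto_compose[rotated])
    then show "continuous (at_right s) (\<lambda>s. c (X s (fst p)) (X s (snd p)))"
      by (simp add: continuous_within)
  qed
  have "(\<lambda>\<omega>. (enn2real (\<tau> k \<omega>), (\<omega> k, \<omega> (Suc k)))) \<in> \<Omega> \<rightarrow>\<^sub>M borel \<Otimes>\<^sub>M (M \<Otimes>\<^sub>M M)" by measurable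
  from measurable_compose[OF this J] show ?thesis
    by (simp add: impulse_cost_def[abs_def] Let_def)
qed

definition total_cost :: "('e \<Rightarrow> 'e \<Rightarrow> real) \<Rightarrow> real \<Rightarrow> (nat \<Rightarrow> 'w) \<Rightarrow> ennreal" where
  "total_cost c T \<omega> = (\<Sum>k. if \<tau> k \<omega> \<le> ennreal T then ennreal (impulse_cost X c V k \<omega>) else 0)"

lemma total_cost_measurable:
  assumes c: "case_prod c \<in> bcontfun" shows "total_cost c T \<in> borel_measurable \<Omega>"
proof -
  note [measurable] = impulse_cost_measurable[OF c]
  show ?thesis unfolding total_cost_def[abs_def] by measurable
qed

text \<open>
  Each impulse costs at least \<open>c0\<close>, so infinitely many of them with positive probability have an
  infinite expected cost.
\<close>

lemma finite_cost_finitely_many: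
  assumes c: "case_prod c \<in> bcontfun" and c0: "0 < c0" "\<And>y z. c0 \<le> c y z"
    and fin: "(\<integral>\<^sup>+\<omega>. total_cost c T \<omega> \<partial>Q) \<noteq> \<infinity>"
  shows "AE \<omega> in Q. \<exists>k. ennreal T < \<tau> k \<omega>"
proof -
  have "AE \<omega> in Q. total_cost c T \<omega> \<noteq> \<infinity>"
    using total_cost_measurable[OF c] fin by (intro nn_integral_PInf_AE) (simp_all add: measurable_Q)
  then show ?thesis
  proof (rule eventually_mono)
    fix \<omega> assume ne: "total_cost c T \<omega> \<noteq> \<infinity>"
    show "\<exists>k. ennreal T < \<tau> k \<omega>"
    proof (rule ccontr)
      assume "\<not> (\<exists>k. ennreal T < \<tau> k \<omega>)"
      then have all: "\<tau> k \<omega> \<le> ennreal T" for k by (simp add: not_less)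
      have "(\<Sum>k::nat. ennreal c0) \<le> total_cost c T \<omega>"
        unfolding total_cost_def
      proof (rule suminf_le[OF _ summableI summableI])
        fix k
        show "ennreal c0 \<le> (if \<tau> k \<omega> \<le> ennreal T then ennreal (impulse_cost X c V k \<omega>) else 0)"
          using all[of k] c0(2) by (simp add: impulse_cost_def Let_def ennreal_leI)
      qed
      moreover have "(\<Sum>k::nat. ennreal c0) = \<infinity>"
        using c0(1) unfolding nn_integral_count_space_nat[symmetric] by (simp add: ennreal_mult_top)
      ultimately show False using ne by (simp add: top_unique)
    qed
  qed
qed

lemma total_cost_grid:
  assumes w: "\<omega> \<in> space \<Omega>" and T: "real n * h \<le> T" "T < (real n + 1) * h"
  shows "total_cost c T \<omega> = total_cost c (real n * h) \<omega>"
proof -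
  have "\<tau> k \<omega> \<le> ennreal T \<longleftrightarrow> \<tau> k \<omega> \<le> ennreal (real n * h)" for k
  proof
    assume le: "\<tau> k \<omega> \<le> ennreal T"
    show "\<tau> k \<omega> \<le> ennreal (real n * h)"
    proof (rule ccontr)
      assume "\<not> \<tau> k \<omega> \<le> ennreal (real n * h)"
      then have "ennreal ((real n + 1) * h) \<le> \<tau> k \<omega>" using grid_gap[OF w, of n k] by simp
      also note le
      also have "ennreal T < ennreal ((real n + 1) * h)"
        using T h by (intro ennreal_lessI) (auto intro: mult_pos_pos)
      finally show False by simp
    qed
  next
    assume "\<tau> k \<omega> \<le> ennreal (real n * h)"
    also have "\<dots> \<le> ennreal T" using T(1) by (rule ennreal_leI)
    finally show "\<tau> k \<omega> \<le> ennreal T" .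
  qed
  then show ?thesis by (simp add: total_cost_def)
qed

lemma running_cost_Fubini:
  assumes f: "(f :: 'e \<Rightarrow> real) \<in> bcontfun" and T: "0 \<le> T"
  shows "(\<lambda>\<omega>. LINT s:{0..T}|lborel. f (Y s \<omega>)) \<in> borel_measurable Q"
    and "(\<integral>\<omega>. (LINT s:{0..T}|lborel. f (Y s \<omega>)) \<partial>Q) = (LINT s:{0..T}|lborel. (\<integral>\<omega>. f (Y (max 0 s) \<omega>) \<partial>Q))"
    and "(\<lambda>s. \<integral>\<omega>. f (Y (max 0 s) \<omega>) \<partial>Q) \<in> borel_measurable borel"
proof -
  interpret prob_space Q by (rule prob_space_Q)
  interpret pair_sigma_finite lborel Q ..
  obtain B where B: "\<And>z. \<bar>f z\<bar> \<le> B" "0 \<le> B" using bcontfun_bound[OF f] by metis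
  let ?k = "\<lambda>s \<omega>. indicator {0..T} s * f (Y (max 0 s) \<omega>)"
  have "sets (lborel \<Otimes>\<^sub>M Q) = sets (borel \<Otimes>\<^sub>M \<Omega>)" by (intro sets_pair_measure_cong) (simp_all add: sets_Q)
  then have "borel_measurable (lborel \<Otimes>\<^sub>M Q) = (borel_measurable (borel \<Otimes>\<^sub>M \<Omega>) :: (real \<times> (nat \<Rightarrow> 'w) \<Rightarrow> real) set)"
    by (rule measurable_cong_sets) simp
  then have J[measurable]: "(\<lambda>p. f (Y (max 0 (fst p)) (snd p))) \<in> borel_measurable (lborel \<Otimes>\<^sub>M Q)"
    using controlled_jointly_measurable[OF f] by (simp only: split_beta')
  have km: "case_prod ?k \<in> borel_measurable (lborel \<Otimes>\<^sub>M Q)" unfolding split_beta' by measurable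
  have eq: "(LINT s:{0..T}|lborel. f (Y s \<omega>)) = (\<integral>s. ?k s \<omega> \<partial>lborel)" for \<omega>
    unfolding set_lebesgue_integral_def
    by (intro Bochner_Integration.integral_cong) (auto split: split_indicator)
  have "(\<lambda>(\<omega>, s). ?k s \<omega>) \<in> borel_measurable (Q \<Otimes>\<^sub>M lborel)"
    using measurable_pair_swap[OF km] by simp
  then have "(\<lambda>\<omega>. \<integral>s. ?k s \<omega> \<partial>lborel) \<in> borel_measurable Q"
    by (rule lborel.borel_measurable_lebesgue_integral)
  then show "(\<lambda>\<omega>. LINT s:{0..T}|lborel. f (Y s \<omega>)) \<in> borel_measurable Q"
    by (simp only: eq)
  have i0: "integrable lborel (\<lambda>s. B * indicator {0..T} s)"
    using T by (intro integrable_mult_right integrable_real_indicator) simp_all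
  have "integrable (lborel \<Otimes>\<^sub>M Q) (\<lambda>p. B * indicator {0..T} (fst p))"
    by (intro Fubini_integrable) (use i0 B in \<open>auto simp: prob_space\<close>)
  then have int: "integrable (lborel \<Otimes>\<^sub>M Q) (case_prod ?k)"
  proof (rule Bochner_Integration.integrable_bound[OF _ km])
    show "AE p in lborel \<Otimes>\<^sub>M Q. norm (case_prod ?k p) \<le> norm (B * indicator {0..T} (fst p))"
      using B by (intro AE_I2) (auto simp: split_beta' abs_mult split: split_indicator)
  qed
  have "(\<integral>\<omega>. (LINT s:{0..T}|lborel. f (Y s \<omega>)) \<partial>Q) = (\<integral>\<omega>. (\<integral>s. ?k s \<omega> \<partial>lborel) \<partial>Q)" by (simp only: eq)
  also have "\<dots> = (\<integral>s. (\<integral>\<omega>. ?k s \<omega> \<partial>Q) \<partial>lborel)" by (rule Fubini_integral[OF int])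
  also have "\<dots> = (LINT s:{0..T}|lborel. (\<integral>\<omega>. f (Y (max 0 s) \<omega>) \<partial>Q))"
    unfolding set_lebesgue_integral_def by simp
  finally show "(\<integral>\<omega>. (LINT s:{0..T}|lborel. f (Y s \<omega>)) \<partial>Q) = (LINT s:{0..T}|lborel. (\<integral>\<omega>. f (Y (max 0 s) \<omega>) \<partial>Q))" .
  have "(\<lambda>(s, \<omega>). f (Y (max 0 s) \<omega>)) \<in> borel_measurable (lborel \<Otimes>\<^sub>M Q)" using J by (simp add: split_beta')
  then have "(\<lambda>s. \<integral>\<omega>. f (Y (max 0 s) \<omega>) \<partial>Q) \<in> borel_measurable lborel"
    by (rule sigma_finite_measure.borel_measurable_lebesgue_integral[rotated]) unfold_locales
  then show "(\<lambda>s. \<integral>\<omega>. f (Y (max 0 s) \<omega>) \<partial>Q) \<in> borel_measurable borel" by simp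
qed

text \<open>
  The impulse costs up to time \<open>T\<close> agree for the two functionals up to the factor \<open>h\<close>. If they are infinite
  in the mean, then so are both expectations. Otherwise there are almost surely finitely many
  impulses up to time \<open>n h\<close>, and the running costs differ by the increments of \<open>E g(Y\<^sub>s)\<close> within the
  cells of the grid and by boundary terms of size \<open>G h\<close>.
\<close>

lemma expected_cost_comparison:
  assumes g: "g \<in> bcontfun" "\<And>z. \<bar>g z\<bar> \<le> G" and c: "case_prod c \<in> bcontfun"
    and c0: "0 < c0" "\<And>y z. c0 \<le> c y z"
    and e: "\<And>r z. 0 \<le> r \<Longrightarrow> r < h \<Longrightarrow> \<bar>Pt r g z - g z\<bar> \<le> e"
    and T: "real n * h \<le> T" "T < (real n + 1) * h"
  defines "A \<equiv> ereal_expectation Q (\<lambda>\<omega>. ereal (LINT s:{0..T}|lborel. g (Y s \<omega>)) + enn2ereal (total_cost c T \<omega>))"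
    and "B \<equiv> ereal_expectation Q (\<lambda>\<omega>. ereal (\<Sum>i=1..n. g (Y (real i * h) \<omega>))
           + enn2ereal (\<Sum>k. if \<tau> k \<omega> \<le> ennreal (real n * h) then ennreal (1 / h * impulse_cost X c V k \<omega>) else 0))"
  shows "(A = \<infinity> \<and> B = \<infinity>) \<or> (\<exists>a b. A = ereal a \<and> B = ereal b \<and> \<bar>a - h * b\<bar> \<le> real n * h * e + 3 * G * h)"
    and "ereal (- (real n * G)) \<le> B"
proof -
  interpret prob_space Q by (rule prob_space_Q)
  define u where "u s = (\<integral>\<omega>. g (Y (max 0 s) \<omega>) \<partial>Q)" for s
  define C where "C = (\<integral>\<^sup>+\<omega>. total_cost c (real n * h) \<omega> \<partial>Q)"
  have nh: "0 \<le> real i * h" for i :: nat using h by simp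
  have T0: "0 \<le> T" using T nh[of n] by linarith
  have G0: "0 \<le> G" using g(2)[of undefined] by simp
  have uG: "\<bar>u s\<bar> \<le> G" for s
  proof -
    have "\<bar>u s\<bar> \<le> (\<integral>\<omega>. G \<partial>Q)" unfolding u_def
      using controlled_integrable[OF g(1), of "max 0 s"] g(2)
      by (intro order_trans[OF integral_abs_bound integral_mono]) auto
    then show ?thesis by (simp add: prob_space)
  qed
  note tcm = total_cost_measurable[OF c]
  have A: "A = ereal (LINT s:{0..T}|lborel. u s) + enn2ereal C"
  proof -
    have "A = ereal (\<integral>\<omega>. (LINT s:{0..T}|lborel. g (Y s \<omega>)) \<partial>Q) + enn2ereal (\<integral>\<^sup>+\<omega>. total_cost c T \<omega> \<partial>Q)"
      unfolding A_def
    proof (rule ereal_expectation_split[OF prob_space_Q running_cost_Fubini(1)[OF g(1) T0]])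
      show "\<bar>LINT s:{0..T}|lborel. g (Y s \<omega>)\<bar> \<le> G * T" for \<omega>
      proof -
        have "\<bar>LINT s:{0..T}|lborel. g (Y s \<omega>)\<bar> \<le> (\<integral>s. G * indicator {0..T} s \<partial>lborel)"
          unfolding set_lebesgue_integral_def real_norm_def[symmetric]
        proof (rule order_trans[OF integral_norm_bound integral_mono'])
          show "integrable lborel (\<lambda>s. G * indicator {0..T} s)"
            using T0 by (intro integrable_mult_right integrable_real_indicator) simp_all
        qed (use G0 g(2) in \<open>auto split: split_indicator\<close>)
        then show ?thesis using T0 by simp
      qed
      show "total_cost c T \<in> borel_measurable Q" using tcm by (simp add: measurable_Q)
    qed
    also have "(\<integral>\<omega>. (LINT s:{0..T}|lborel. g (Y s \<omega>)) \<partial>Q) = (LINT s:{0..T}|lborel. u s)"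
      unfolding u_def by (rule running_cost_Fubini(2)[OF g(1) T0])
    also have "(\<integral>\<^sup>+\<omega>. total_cost c T \<omega> \<partial>Q) = C"
      unfolding C_def by (rule nn_integral_cong) (simp add: total_cost_grid[OF _ T] space_Q)
    finally show ?thesis .
  qed
  have B: "B = ereal (\<Sum>i=1..n. u (real i * h)) + enn2ereal (ennreal (1 / h) * C)"
  proof -
    have scale: "(\<Sum>k. if \<tau> k \<omega> \<le> ennreal (real n * h) then ennreal (1 / h * impulse_cost X c V k \<omega>) else 0)
        = ennreal (1 / h) * total_cost c (real n * h) \<omega>" for \<omega>
    proof -
      have "0 \<le> impulse_cost X c V k \<omega>" for k
        using order_trans[OF less_imp_le[OF c0(1)] c0(2)] by (simp add: impulse_cost_def Let_def)
      then have "ennreal (1 / h * impulse_cost X c V k \<omega>) = ennreal (1 / h) * ennreal (impulse_cost X c V k \<omega>)" for k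
        using h by (intro ennreal_mult) simp_all
      then show ?thesis
        unfolding total_cost_def ennreal_suminf_cmult[symmetric] by (intro suminf_cong) simp
    qed
    have "B = ereal (\<integral>\<omega>. (\<Sum>i=1..n. g (Y (real i * h) \<omega>)) \<partial>Q) + enn2ereal (\<integral>\<^sup>+\<omega>. ennreal (1 / h) * total_cost c (real n * h) \<omega> \<partial>Q)"
      unfolding B_def scale
    proof (rule ereal_expectation_split[OF prob_space_Q])
      show "(\<lambda>\<omega>. \<Sum>i=1..n. g (Y (real i * h) \<omega>)) \<in> borel_measurable Q"
        using controlled_integrable[OF g(1) nh] by (intro borel_measurable_sum borel_measurable_integrable)
      show "\<bar>\<Sum>i=1..n. g (Y (real i * h) \<omega>)\<bar> \<le> real n * G" for \<omega>
        using sum_bounded_above[of "{1..n}" "\<lambda>i. \<bar>g (Y (real i * h) \<omega>)\<bar>" G] g(2)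
        by (intro order_trans[OF sum_abs]) simp
      show "(\<lambda>\<omega>. ennreal (1 / h) * total_cost c (real n * h) \<omega>) \<in> borel_measurable Q"
        using tcm by (simp add: measurable_Q)
    qed
    also have "(\<integral>\<omega>. (\<Sum>i=1..n. g (Y (real i * h) \<omega>)) \<partial>Q) = (\<Sum>i=1..n. u (real i * h))"
    proof -
      have "max 0 (real i * h) = real i * h" for i :: nat using nh[of i] by simp
      then show ?thesis
        unfolding u_def using controlled_integrable[OF g(1) nh] by (simp only: Bochner_Integration.integral_sum)
    qed
    also have "(\<integral>\<^sup>+\<omega>. ennreal (1 / h) * total_cost c (real n * h) \<omega> \<partial>Q) = ennreal (1 / h) * C"
      unfolding C_def using tcm by (intro nn_integral_cmult) (simp add: measurable_Q)
    finally show ?thesis .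
  qed
  have "\<bar>\<Sum>i=1..n. u (real i * h)\<bar> \<le> real n * G"
    using sum_bounded_above[of "{1..n}" "\<lambda>i. \<bar>u (real i * h)\<bar>" G] uG
    by (intro order_trans[OF sum_abs]) simp
  then have "ereal (- (real n * G)) + 0 \<le> B"
    unfolding B by (intro add_mono) simp_all
  then show "ereal (- (real n * G)) \<le> B" by simp
  show "(A = \<infinity> \<and> B = \<infinity>) \<or> (\<exists>a b. A = ereal a \<and> B = ereal b \<and> \<bar>a - h * b\<bar> \<le> real n * h * e + 3 * G * h)"
  proof (cases "C = \<infinity>")
    case True
    then have "A = \<infinity>" "B = \<infinity>" using h unfolding A B by (simp_all add: ennreal_mult_top)
    then show ?thesis by simp
  next
    case False
    then obtain \<gamma> where \<gamma>: "0 \<le> \<gamma>" "C = ennreal \<gamma>" by (cases C) auto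
    have ae: "AE \<omega> in Q. \<exists>k. ennreal (real i * h) < \<tau> k \<omega>" if i: "i < n" for i
    proof -
      have "AE \<omega> in Q. \<exists>k. ennreal (real n * h) < \<tau> k \<omega>"
        using False by (intro finite_cost_finitely_many[OF c c0]) (simp add: C_def)
      moreover have "ennreal (real i * h) \<le> ennreal (real n * h)"
        using i h by (intro ennreal_leI mult_right_mono) simp_all
      ultimately show ?thesis by (auto elim!: eventually_mono intro: order_le_less_trans)
    qed
    have inc: "\<bar>u (real i * h + r) - u (real i * h)\<bar> \<le> e" if "i < n" "0 \<le> r" "r < h" for i r
    proof -
      have m: "max 0 (real i * h + r) = real i * h + r" "max 0 (real i * h) = real i * h"
        using nh[of i] that by simp_all
      show ?thesis unfolding u_def m
        by (rule expected_increment[OF g(1) that(2,3) e[OF that(2,3)] ae[OF that(1)]])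
    qed
    have "\<bar>(LINT s:{0..T}|lborel. u s) - h * (\<Sum>i=1..n. u (real i * h))\<bar> \<le> real n * h * e + 3 * G * h"
    proof (rule integral_grid_sum_difference[OF _ uG h inc T])
      show "u \<in> borel_measurable borel"
        using running_cost_Fubini(3)[OF g(1) T0] by (simp only: u_def[abs_def])
    qed
    moreover have "A = ereal ((LINT s:{0..T}|lborel. u s) + \<gamma>)"
      unfolding A \<gamma>(2) using \<gamma>(1) by simp
    moreover have "B = ereal ((\<Sum>i=1..n. u (real i * h)) + 1 / h * \<gamma>)"
    proof -
      have "ennreal (1 / h) * C = ennreal (1 / h * \<gamma>)" unfolding \<gamma>(2) using \<gamma>(1) h by (intro ennreal_mult[symmetric]) simp_all
      then show ?thesis unfolding B using \<gamma>(1) h by simp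
    qed
    moreover have "(LINT s:{0..T}|lborel. u s) + \<gamma> - h * ((\<Sum>i=1..n. u (real i * h)) + 1 / h * \<gamma>)
        = (LINT s:{0..T}|lborel. u s) - h * (\<Sum>i=1..n. u (real i * h))"
      using h by (simp add: distrib_left)
    ultimately show ?thesis by metis
  qed
qed

lemma average_cost_comparison:
  assumes PV: "PV x V = Q"
    and g: "g \<in> bcontfun" "\<And>z. \<bar>g z\<bar> \<le> G" and c: "case_prod c \<in> bcontfun"
    and c0: "0 < c0" "\<And>y z. c0 \<le> c y z"
    and e: "\<And>r z. 0 \<le> r \<Longrightarrow> r < h \<Longrightarrow> \<bar>Pt r g z - g z\<bar> \<le> e"
  shows "discrete_avg_cost X g c PV h x V \<le> avg_cost X g c PV x V + ereal e"
    and "avg_cost X g c PV x V \<le> discrete_avg_cost X g c PV h x V + ereal e"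
    and "ereal (- G) \<le> discrete_avg_cost X g c PV h x V"
proof -
  define A where "A T = ereal_expectation Q (\<lambda>\<omega>. ereal (LINT s:{0..T}|lborel. g (Y s \<omega>)) + enn2ereal (total_cost c T \<omega>))" for T
  define B where "B n = ereal_expectation Q (\<lambda>\<omega>. ereal (\<Sum>i=1..n. g (Y (real i * h) \<omega>))
      + enn2ereal (\<Sum>k. if \<tau> k \<omega> \<le> ennreal (real n * h) then ennreal (1 / h * impulse_cost X c V k \<omega>) else 0))" for n
  have J: "avg_cost X g c PV x V = Limsup at_top (\<lambda>T. A T / ereal T)"
    unfolding avg_cost_def A_def total_cost_def PV ..
  have Jh: "discrete_avg_cost X g c PV h x V = limsup (\<lambda>n. ereal (1 / real n) * B n)"
    unfolding discrete_avg_cost_def B_def PV ..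
  have cmp: "(A T = \<infinity> \<and> B n = \<infinity>) \<or> (\<exists>a b. A T = ereal a \<and> B n = ereal b \<and> \<bar>a - h * b\<bar> \<le> real n * h * e + 3 * G * h)"
    if "real n * h \<le> T" "T < (real n + 1) * h" for n T
    unfolding A_def B_def by (rule expected_cost_comparison(1)[OF g c c0 e that])
  show "discrete_avg_cost X g c PV h x V \<le> avg_cost X g c PV x V + ereal e"
    "avg_cost X g c PV x V \<le> discrete_avg_cost X g c PV h x V + ereal e"
    unfolding J Jh by (rule average_limits[OF h cmp]; assumption)+
  have "ereal (- G) \<le> ereal (1 / real n) * B n" if n: "0 < n" for n
  proof -
    have "ereal (- (real n * G)) \<le> B n"
      unfolding B_def using h by (intro expected_cost_comparison(2)[OF g c c0 e, of n "real n * h"]) simp_all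
    then have "ereal (1 / real n) * ereal (- (real n * G)) \<le> ereal (1 / real n) * B n"
      by (rule ereal_mult_left_mono) simp
    with n show ?thesis by simp
  qed
  then have "\<forall>\<^sub>F n in sequentially. ereal (- G) \<le> ereal (1 / real n) * B n"
    using eventually_gt_at_top[of 0] by (rule eventually_mono[rotated])
  then show "ereal (- G) \<le> discrete_avg_cost X g c PV h x V"
    unfolding Jh by (intro le_Limsup) simp_all
qed

text \<open>
  Together with the lower bound by the running cost, abstaining from impulses makes the infima finite,
  so that their difference is meaningful.
\<close>

lemma no_impulse_cost:
  assumes PV: "PV x V = Q" and g: "g \<in> bcontfun" "\<And>z. \<bar>g z\<bar> \<le> G" and inf: "\<And>k \<omega>. \<tau> k \<omega> = \<infinity>"
  shows "discrete_avg_cost X g c PV h x V \<le> ereal G"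
proof -
  interpret prob_space Q by (rule prob_space_Q)
  have nh: "0 \<le> real i * h" for i :: nat using h by simp
  have "ereal (1 / real n) * ereal_expectation Q (\<lambda>\<omega>. ereal (\<Sum>i=1..n. g (Y (real i * h) \<omega>))
      + enn2ereal (\<Sum>k. if \<tau> k \<omega> \<le> ennreal (real n * h) then ennreal (1 / h * impulse_cost X c V k \<omega>) else 0)) \<le> ereal G"
    if n: "0 < n" for n
  proof -
    have b: "\<bar>\<Sum>i=1..n. g (Y (real i * h) \<omega>)\<bar> \<le> real n * G" for \<omega>
      using sum_bounded_above[of "{1..n}" "\<lambda>i. \<bar>g (Y (real i * h) \<omega>)\<bar>" G] g(2)
      by (intro order_trans[OF sum_abs]) simp
    have m: "(\<lambda>\<omega>. \<Sum>i=1..n. g (Y (real i * h) \<omega>)) \<in> borel_measurable Q"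
      using controlled_integrable[OF g(1) nh] by (intro borel_measurable_sum borel_measurable_integrable)
    have z: "(\<Sum>k. if \<tau> k \<omega> \<le> ennreal (real n * h) then ennreal (1 / h * impulse_cost X c V k \<omega>) else 0) = (0 :: ennreal)" for \<omega>
      by (simp add: inf top_unique)
    have "ereal_expectation Q (\<lambda>\<omega>. ereal (\<Sum>i=1..n. g (Y (real i * h) \<omega>))
      + enn2ereal (\<Sum>k. if \<tau> k \<omega> \<le> ennreal (real n * h) then ennreal (1 / h * impulse_cost X c V k \<omega>) else 0))
      = ereal (\<integral>\<omega>. (\<Sum>i=1..n. g (Y (real i * h) \<omega>)) \<partial>Q)"
      unfolding z ereal_expectation_split[OF prob_space_Q m b borel_measurable_const]
      by (simp add: zero_ennreal.rep_eq)
    also have "\<dots> \<le> ereal (real n * G)"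
    proof -
      have "(\<integral>\<omega>. (\<Sum>i=1..n. g (Y (real i * h) \<omega>)) \<partial>Q) \<le> (\<integral>\<omega>. real n * G \<partial>Q)"
      proof (rule integral_mono[OF integrable_const_bound[of _ "real n * G"] integrable_const])
        show "AE \<omega> in Q. norm (\<Sum>i=1..n. g (Y (real i * h) \<omega>)) \<le> real n * G" using b by simp
        show "(\<Sum>i=1..n. g (Y (real i * h) \<omega>)) \<le> real n * G" for \<omega> using b[of \<omega>] by linarith
      qed (rule m)
      then show ?thesis by (simp add: prob_space)
    qed
    finally have "ereal (1 / real n) * ereal_expectation Q (\<lambda>\<omega>. ereal (\<Sum>i=1..n. g (Y (real i * h) \<omega>))
      + enn2ereal (\<Sum>k. if \<tau> k \<omega> \<le> ennreal (real n * h) then ennreal (1 / h * impulse_cost X c V k \<omega>) else 0))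
      \<le> ereal (1 / real n) * ereal (real n * G)"
      by (rule ereal_mult_left_mono) simp
    with n show ?thesis by simp
  qed
  then show ?thesis
    unfolding discrete_avg_cost_def PV
    by (intro Limsup_bounded eventually_mono[OF eventually_gt_at_top[of 0]]) blast
qed

end

section \<open>Comparison of the optimal values\<close>

lemma no_impulse_grid_strategy: "(\<lambda>k. (\<lambda>_. \<infinity>, \<lambda>_. x)) \<in> grid_strategies M F h"
  by (simp add: grid_strategies_def strategies_def imp_time_def imp_state_def stopping_time_const)

text \<open>
  The bounds by \<open>G\<close> keep both infima finite and thereby exclude \<open>\<infinity> - \<infinity>\<close>.
\<close>

lemma abs_INF_difference_le:
  fixes f f' :: "'a \<Rightarrow> ereal"
  assumes le: "\<And>v. v \<in> S \<Longrightarrow> f v \<le> f' v + ereal e" "\<And>v. v \<in> S \<Longrightarrow> f' v \<le> f v + ereal e"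
    and lo: "\<And>v. v \<in> S \<Longrightarrow> ereal (- G) \<le> f v" and w: "w \<in> S" "f w \<le> ereal G"
  shows "\<bar>(INF v\<in>S. f v) - (INF v\<in>S. f' v)\<bar> \<le> ereal e"
proof -
  have "(INF v\<in>S. f v) \<le> (INF v\<in>S. f' v) + ereal e"
  proof -
    have "(INF v\<in>S. f v) - ereal e \<le> (INF v\<in>S. f' v)"
    proof (rule INF_greatest)
      fix v assume v: "v \<in> S"
      have "(INF v\<in>S. f v) \<le> f' v + ereal e" using INF_lower[OF v, of f] le(1)[OF v] by (rule order_trans)
      then show "(INF v\<in>S. f v) - ereal e \<le> f' v" by (simp add: ereal_minus_le)
    qed
    then show ?thesis by (simp add: ereal_minus_le)
  qed
  moreover have "(INF v\<in>S. f' v) \<le> (INF v\<in>S. f v) + ereal e"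
  proof -
    have "(INF v\<in>S. f' v) - ereal e \<le> (INF v\<in>S. f v)"
    proof (rule INF_greatest)
      fix v assume v: "v \<in> S"
      have "(INF v\<in>S. f' v) \<le> f v + ereal e" using INF_lower[OF v, of f'] le(2)[OF v] by (rule order_trans)
      then show "(INF v\<in>S. f' v) - ereal e \<le> f v" by (simp add: ereal_minus_le)
    qed
    then show ?thesis by (simp add: ereal_minus_le)
  qed
  moreover have "ereal (- G) \<le> (INF v\<in>S. f v)" using lo by (rule INF_greatest)
  moreover have "(INF v\<in>S. f v) \<le> ereal G" using INF_lower[OF w(1)] w(2) by (rule order_trans)
  ultimately show ?thesis
    by (cases "INF v\<in>S. f v"; cases "INF v\<in>S. f' v") (auto simp: abs_le_iff)
qed

theorem theorem4p3:
  fixes M :: "'w measure"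
    and F :: "ennreal \<Rightarrow> 'w measure"
    and X :: "real \<Rightarrow> 'w \<Rightarrow> 'e::{metric_space, second_countable_topology}"
    and P :: "'e \<Rightarrow> 'w measure"
    and PV :: "'e \<Rightarrow> ('w, 'e) strategy \<Rightarrow> (nat \<Rightarrow> 'w) measure"
    and g :: "'e \<Rightarrow> real"
    and c :: "'e \<Rightarrow> 'e \<Rightarrow> real"
    and c0 :: real
    and x :: 'e
  assumes "compact (UNIV :: 'e set)"
    and "standard_process M F X P"
    and "g \<in> bcontfun"
    and "case_prod c \<in> bcontfun"
    and "0 < c0"
    and "\<And>y \<xi>. c0 \<le> c y \<xi>"
    and "\<And>y \<xi> \<eta>. c y \<xi> \<le> c y \<eta> + c \<eta> \<xi>"
    and "feller_property X P"
    and "uniformly_ergodic X P"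
    and "\<And>y V. V \<in> strategies M F \<Longrightarrow> controlled_law M F X P y V (PV y V)"
  shows "((\<lambda>h::real. \<bar>(INF V\<in>grid_strategies M F h. discrete_avg_cost X g c PV h x V)
                      - (INF V\<in>grid_strategies M F h. avg_cost X g c PV x V)\<bar>)
          \<longlongrightarrow> (0::ereal)) (at_right 0)"
proof -
  interpret compact_feller_process M F X P
    using assms(1,2,8) by unfold_locales (simp_all add: standard_process_def)
  obtain G where G: "\<And>z. \<bar>g z\<bar> \<le> G" using bcontfun_bound[OF assms(3)] by metis
  let ?D = "\<lambda>h::real. \<bar>(INF V\<in>grid_strategies M F h. discrete_avg_cost X g c PV h x V)
                      - (INF V\<in>grid_strategies M F h. avg_cost X g c PV x V)\<bar>"
  have small: "\<forall>\<^sub>F h in at_right 0. ?D h \<le> ereal e" if e: "0 < e" for e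
  proof -
    obtain t0 where t0: "0 < t0" "\<And>t z. 0 \<le> t \<Longrightarrow> t \<le> t0 \<Longrightarrow> \<bar>Pt t g z - g z\<bar> \<le> e"
      using semigroup_strongly_continuous[OF assms(3) e] by metis
    have "?D h \<le> ereal e" if h: "0 < h" "h < t0" for h
    proof (rule abs_INF_difference_le[OF _ _ _ no_impulse_grid_strategy[of x M F h]])
      have loc: "grid_controlled_process M F X P h V x (PV x V)" if "V \<in> grid_strategies M F h" for V
        using that h(1) assms(10)[of V x] by unfold_locales (auto simp: grid_strategies_def)
      have inc: "\<bar>Pt r g z - g z\<bar> \<le> e" if "0 \<le> r" "r < h" for r z using t0(2)[of r z] that h by simp
      note cmp = grid_controlled_process.average_cost_comparison[where PV=PV and x=x and h=h and g=g and c=c,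
          OF loc refl assms(3) G assms(4-6) inc]
      show "discrete_avg_cost X g c PV h x V \<le> avg_cost X g c PV x V + ereal e" if "V \<in> grid_strategies M F h" for V
        by (rule cmp(1)[OF that])
      show "avg_cost X g c PV x V \<le> discrete_avg_cost X g c PV h x V + ereal e" if "V \<in> grid_strategies M F h" for V
        by (rule cmp(2)[OF that])
      show "ereal (- G) \<le> discrete_avg_cost X g c PV h x V" if "V \<in> grid_strategies M F h" for V
        by (rule cmp(3)[OF that])
      show "discrete_avg_cost X g c PV h x (\<lambda>k. (\<lambda>_. \<infinity>, \<lambda>_. x)) \<le> ereal G"
        by (rule grid_controlled_process.no_impulse_cost[where PV=PV and x=x and h=h and g=g and c=c, OF loc[OF no_impulse_grid_strategy] refl assms(3) G])
          (simp add: imp_time_def)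
    qed
    then show ?thesis
      using t0(1) unfolding eventually_at_right[OF t0(1)] by (intro exI[of _ t0]) simp
  qed
  show ?thesis
  proof (rule order_tendstoI)
    fix a :: ereal assume "a < 0"
    moreover have "0 \<le> \<bar>z\<bar>" for z :: ereal by (cases z) simp_all
    ultimately show "\<forall>\<^sub>F h in at_right 0. a < ?D h"
      by (intro always_eventually allI) (rule order_less_le_trans)
  next
    fix a :: ereal assume "0 < a"
    then obtain e where "ereal 0 < ereal e" "ereal e < a" using ereal_dense2[of 0 a] by (auto simp: zero_ereal_def)
    then show "\<forall>\<^sub>F h in at_right 0. ?D h < a" using small[of e] by (auto elim!: eventually_mono intro: order_le_less_trans)
  qed
qed

end
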